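(* Let $H$ be a Hopf coquasigroup in $\mathsf{C}$ with antipode $S_H$. Let $J:K\to H\otimes H$ be a conormal twist, and let $H_J=(H,\eta_H,\mu_H,\varepsilon_H,\delta_{H_J})$ be the twist deformation of $H$ by $J$, which is a non-coassociative bimonoid. Then $H_J$ is a Hopf coquasigroup.
   Context: $\mathsf{C}$ is a strict symmetric monoidal category with tensor product $\otimes$, unit object $K$ and symmetry $c$. For an object $P$ and a morphism $f$, write $P\otimes f$ for $\mathrm{id}_P\otimes f$ and $f\otimes P$ for $f\otimes \mathrm{id}_P$. For monoids $A,B$, the object $A\otimes B$ is a monoid with unit $\eta_A\otimes\eta_B$ and product $\mu_{A\otimes B}=(\mu_A\otimes\mu_B)\circ(A\otimes c_{B,A}\otimes B)$. A counital comagma is a triple $(D,\varepsilon_D,\delta_D)$ with $\varepsilon_D:D\to K$, $\delta_D:D\to D\otimes D$ such that $(\varepsilon_D\otimes D)\circ\delta_D=\mathrm{id}_D=(D\otimes\varepsilon_D)\circ\delta_D$ (no coassociativity required). A non-coassociative bimonoid is an object $H$ with a monoid structure $(H,\eta_H,\mu_H)$ (unital and associative) and a counital comagma structure $(H,\varepsilon_H,\delta_H)$ such that $\varepsilon_H\circ\eta_H=\mathrm{id}_K$, $\delta_H\circ\eta_H=\eta_H\otimes\eta_H$, $\varepsilon_H\circ\mu_H=\varepsilon_H\otimes\varepsilon_H$, and $\delta_H\circ\mu_H=\mu_{H\otimes H}\circ(\delta_H\otimes\delta_H)$. A Hopf coquasigroup is a non-coassociative bimonoid $H$ for which there exists a morphism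 $S_H:H\to H$ (the antipode) satisfying both $$(H\otimes\mu_H)\circ(\delta_H\otimes S_H)\circ\delta_H=H\otimes\eta_H=(H\otimes\mu_H)\circ(((H\otimes S_H)\circ\delta_H)\otimes H)\circ\delta_H$$ and $$(\mu_H\otimes H)\circ(S_H\otimes\delta_H)\circ\delta_H=\eta_H\otimes H=(\mu_H\otimes H)\circ(H\otimes((S_H\otimes H)\circ\delta_H))\circ\delta_H.$$ For a monoid $A$ and $f,g:K\to A$, the convolution product is $f\ast g=\mu_A\circ(f\otimes g)$; $f$ is convolution invertible if there is $f^{-1}:K\to A$ with $f\ast f^{-1}=f^{-1}\ast f=\eta_A$. A twist for $H$ is a convolution invertible morphism $J:K\to H\otimes H$ (convolution taken in the monoid $H\otimes H$), with inverse $J^{-1}$, such that, in the monoid $H\otimes H\otimes H$, $$((\delta_H\otimes H)\circ J)\ast(J\otimes\eta_H)=((H\otimes\delta_H)\circ J)\ast(\eta_H\otimes J).$$ $J$ is conormal if $(\varepsilon_H\otimes H)\circ J=\eta_H=(H\otimes\varepsilon_H)\circ J$. The coproduct of the twist deformation $H_J$ is $$\delta_{H_J}=\mu_{H\otimes H}\circ(\mu_{H\otimes H}\otimes H\otimes H)\circ(J^{-1}\otimes\delta_H\otimes J).$$ *)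

theory Defs
  imports Main
begin

section \<open>Strict symmetric monoidal categories\<close>

text \<open>Categories are given by sets of objects and arrows with total operations; the values of
  these operations outside the carriers (or on non-composable pairs) are irrelevant.\<close>

record ('o, 'a) sm_struct =
  Obj :: "'o set"
  Arr :: "'a set"
  Dom :: "'a \<Rightarrow> 'o"
  Cod :: "'a \<Rightarrow> 'o"
  ident :: "'o \<Rightarrow> 'a" ("\<one>\<index>")
  cmp :: "'a \<Rightarrow> 'a \<Rightarrow> 'a" (infixr "\<cdot>\<index>" 70)
  tensor_obj :: "'o \<Rightarrow> 'o \<Rightarrow> 'o" (infixl "\<odot>\<index>" 80)
  tensor_arr :: "'a \<Rightarrow> 'a \<Rightarrow> 'a" (infixl "\<otimes>\<index>" 80)
  unit_obj :: "'o" ("\<bbbK>\<index>")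
  symm :: "'o \<Rightarrow> 'o \<Rightarrow> 'a" ("\<sigma>\<index>")

definition hom :: "('o, 'a, 'm) sm_struct_scheme \<Rightarrow> 'o \<Rightarrow> 'o \<Rightarrow> 'a set" where
  "hom C A B = {f \<in> Arr C. Dom C f = A \<and> Cod C f = B}"

locale category =
  fixes C :: "('o, 'a, 'm) sm_struct_scheme" (structure)
  assumes Dom_closed: "f \<in> Arr C \<Longrightarrow> Dom C f \<in> Obj C"
    and Cod_closed: "f \<in> Arr C \<Longrightarrow> Cod C f \<in> Obj C"
    and ident_closed: "A \<in> Obj C \<Longrightarrow> \<one> A \<in> hom C A A"
    and cmp_closed: "f \<in> hom C X Y \<Longrightarrow> g \<in> hom C Y Z \<Longrightarrow> g \<cdot> f \<in> hom C X Z"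
    and cmp_ident_right: "f \<in> hom C X Y \<Longrightarrow> f \<cdot> \<one> X = f"
    and cmp_ident_left: "f \<in> hom C X Y \<Longrightarrow> \<one> Y \<cdot> f = f"
    and cmp_assoc: "f \<in> hom C W X \<Longrightarrow> g \<in> hom C X Y \<Longrightarrow> h \<in> hom C Y Z
      \<Longrightarrow> (h \<cdot> g) \<cdot> f = h \<cdot> (g \<cdot> f)"

locale strict_monoidal_category = category C
  for C :: "('o, 'a, 'm) sm_struct_scheme" (structure) +
  assumes unit_obj_closed: "\<bbbK> \<in> Obj C"
    and tensor_obj_closed: "A \<in> Obj C \<Longrightarrow> B \<in> Obj C \<Longrightarrow> A \<odot> B \<in> Obj C"
    and tensor_arr_closed: "f \<in> hom C A A' \<Longrightarrow> g \<in> hom C B B'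
      \<Longrightarrow> f \<otimes> g \<in> hom C (A \<odot> B) (A' \<odot> B')"
    and tensor_ident: "A \<in> Obj C \<Longrightarrow> B \<in> Obj C \<Longrightarrow> \<one> A \<otimes> \<one> B = \<one> (A \<odot> B)"
    and interchange: "f \<in> hom C A A' \<Longrightarrow> f' \<in> hom C A' A'' \<Longrightarrow> g \<in> hom C B B' \<Longrightarrow> g' \<in> hom C B' B''
      \<Longrightarrow> (f' \<otimes> g') \<cdot> (f \<otimes> g) = (f' \<cdot> f) \<otimes> (g' \<cdot> g)"
    and tensor_obj_assoc: "X \<in> Obj C \<Longrightarrow> Y \<in> Obj C \<Longrightarrow> Z \<in> Obj C
      \<Longrightarrow> (X \<odot> Y) \<odot> Z = X \<odot> (Y \<odot> Z)"
    and tensor_arr_assoc: "f \<in> Arr C \<Longrightarrow> g \<in> Arr C \<Longrightarrow> h \<in> Arr C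
      \<Longrightarrow> (f \<otimes> g) \<otimes> h = f \<otimes> (g \<otimes> h)"
    and tensor_obj_unit_left: "A \<in> Obj C \<Longrightarrow> \<bbbK> \<odot> A = A"
    and tensor_obj_unit_right: "A \<in> Obj C \<Longrightarrow> A \<odot> \<bbbK> = A"
    and tensor_arr_unit_left: "f \<in> Arr C \<Longrightarrow> \<one> \<bbbK> \<otimes> f = f"
    and tensor_arr_unit_right: "f \<in> Arr C \<Longrightarrow> f \<otimes> \<one> \<bbbK> = f"

text \<open>The second hexagon and the compatibility of the symmetry with the unit object follow from
  the axioms below.\<close>

locale strict_symmetric_monoidal_category = strict_monoidal_category C
  for C :: "('o, 'a, 'm) sm_struct_scheme" (structure) +
  assumes symm_closed: "A \<in> Obj C \<Longrightarrow> B \<in> Obj C \<Longrightarrow> \<sigma> A B \<in> hom C (A \<odot> B) (B \<odot> A)"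
    and symm_natural: "f \<in> hom C A A' \<Longrightarrow> g \<in> hom C B B'
      \<Longrightarrow> \<sigma> A' B' \<cdot> (f \<otimes> g) = (g \<otimes> f) \<cdot> \<sigma> A B"
    and symm_involutive: "A \<in> Obj C \<Longrightarrow> B \<in> Obj C \<Longrightarrow> \<sigma> B A \<cdot> \<sigma> A B = \<one> (A \<odot> B)"
    and symm_hexagon: "X \<in> Obj C \<Longrightarrow> Y \<in> Obj C \<Longrightarrow> Z \<in> Obj C
      \<Longrightarrow> \<sigma> X (Y \<odot> Z) = (\<one> Y \<otimes> \<sigma> X Z) \<cdot> (\<sigma> X Y \<otimes> \<one> Z)"


section \<open>Monoids, comagmas and Hopf coquasigroups\<close>

context
  fixes C :: "('o, 'a, 'm) sm_struct_scheme" (structure)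
begin

definition is_monoid :: "'o \<Rightarrow> 'a \<Rightarrow> 'a \<Rightarrow> bool" where
  "is_monoid A \<eta> \<mu> \<longleftrightarrow>
     A \<in> Obj C \<and> \<eta> \<in> hom C \<bbbK> A \<and> \<mu> \<in> hom C (A \<odot> A) A \<and>
     \<mu> \<cdot> (\<eta> \<otimes> \<one> A) = \<one> A \<and> \<mu> \<cdot> (\<one> A \<otimes> \<eta>) = \<one> A \<and>
     \<mu> \<cdot> (\<mu> \<otimes> \<one> A) = \<mu> \<cdot> (\<one> A \<otimes> \<mu>)"

definition tensor_mult :: "'o \<Rightarrow> 'a \<Rightarrow> 'o \<Rightarrow> 'a \<Rightarrow> 'a" where
  "tensor_mult A \<mu>A B \<mu>B = (\<mu>A \<otimes> \<mu>B) \<cdot> (\<one> A \<otimes> \<sigma> B A \<otimes> \<one> B)"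

definition is_counital_comagma :: "'o \<Rightarrow> 'a \<Rightarrow> 'a \<Rightarrow> bool" where
  "is_counital_comagma D \<epsilon> \<delta> \<longleftrightarrow>
     D \<in> Obj C \<and> \<epsilon> \<in> hom C D \<bbbK> \<and> \<delta> \<in> hom C D (D \<odot> D) \<and>
     (\<epsilon> \<otimes> \<one> D) \<cdot> \<delta> = \<one> D \<and> (\<one> D \<otimes> \<epsilon>) \<cdot> \<delta> = \<one> D"

definition is_noncoassociative_bimonoid :: "'o \<Rightarrow> 'a \<Rightarrow> 'a \<Rightarrow> 'a \<Rightarrow> 'a \<Rightarrow> bool" where
  "is_noncoassociative_bimonoid H \<eta> \<mu> \<epsilon> \<delta> \<longleftrightarrow>
     is_monoid H \<eta> \<mu> \<and> is_counital_comagma H \<epsilon> \<delta> \<and>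
     \<epsilon> \<cdot> \<eta> = \<one> \<bbbK> \<and>
     \<delta> \<cdot> \<eta> = \<eta> \<otimes> \<eta> \<and>
     \<epsilon> \<cdot> \<mu> = \<epsilon> \<otimes> \<epsilon> \<and>
     \<delta> \<cdot> \<mu> = tensor_mult H \<mu> H \<mu> \<cdot> (\<delta> \<otimes> \<delta>)"

definition is_antipode :: "'o \<Rightarrow> 'a \<Rightarrow> 'a \<Rightarrow> 'a \<Rightarrow> 'a \<Rightarrow> bool" where
  "is_antipode H \<eta> \<mu> \<delta> S \<longleftrightarrow>
     S \<in> hom C H H \<and>
     (\<one> H \<otimes> \<mu>) \<cdot> (\<delta> \<otimes> S) \<cdot> \<delta> = \<one> H \<otimes> \<eta> \<and>
     (\<one> H \<otimes> \<mu>) \<cdot> (((\<one> H \<otimes> S) \<cdot> \<delta>) \<otimes> \<one> H) \<cdot> \<delta> = \<one> H \<otimes> \<eta> \<and>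
     (\<mu> \<otimes> \<one> H) \<cdot> (S \<otimes> \<delta>) \<cdot> \<delta> = \<eta> \<otimes> \<one> H \<and>
     (\<mu> \<otimes> \<one> H) \<cdot> (\<one> H \<otimes> ((S \<otimes> \<one> H) \<cdot> \<delta>)) \<cdot> \<delta> = \<eta> \<otimes> \<one> H"

definition is_hopf_coquasigroup :: "'o \<Rightarrow> 'a \<Rightarrow> 'a \<Rightarrow> 'a \<Rightarrow> 'a \<Rightarrow> bool" where
  "is_hopf_coquasigroup H \<eta> \<mu> \<epsilon> \<delta> \<longleftrightarrow>
     is_noncoassociative_bimonoid H \<eta> \<mu> \<epsilon> \<delta> \<and> (\<exists>S. is_antipode H \<eta> \<mu> \<delta> S)"


section \<open>Convolution and twists\<close>

definition conv :: "'a \<Rightarrow> 'a \<Rightarrow> 'a \<Rightarrow> 'a" where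
  "conv \<mu> f g = \<mu> \<cdot> (f \<otimes> g)"

definition is_conv_inverse :: "'o \<Rightarrow> 'a \<Rightarrow> 'a \<Rightarrow> 'a \<Rightarrow> 'a \<Rightarrow> bool" where
  "is_conv_inverse A \<eta> \<mu> f g \<longleftrightarrow>
     g \<in> hom C \<bbbK> A \<and> conv \<mu> f g = \<eta> \<and> conv \<mu> g f = \<eta>"

text \<open>Convolution inverses in a monoid are unique when they exist.\<close>

definition conv_inverse :: "'o \<Rightarrow> 'a \<Rightarrow> 'a \<Rightarrow> 'a \<Rightarrow> 'a" where
  "conv_inverse A \<eta> \<mu> f = (THE g. is_conv_inverse A \<eta> \<mu> f g)"

definition is_twist :: "'o \<Rightarrow> 'a \<Rightarrow> 'a \<Rightarrow> 'a \<Rightarrow> 'a \<Rightarrow> bool" where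
  "is_twist H \<eta> \<mu> \<delta> J \<longleftrightarrow>
     (let \<mu>2 = tensor_mult H \<mu> H \<mu>;
          \<mu>3 = tensor_mult (H \<odot> H) \<mu>2 H \<mu>
      in J \<in> hom C \<bbbK> (H \<odot> H) \<and>
         (\<exists>g. is_conv_inverse (H \<odot> H) (\<eta> \<otimes> \<eta>) \<mu>2 J g) \<and>
         conv \<mu>3 ((\<delta> \<otimes> \<one> H) \<cdot> J) (J \<otimes> \<eta>) = conv \<mu>3 ((\<one> H \<otimes> \<delta>) \<cdot> J) (\<eta> \<otimes> J))"

definition is_conormal :: "'o \<Rightarrow> 'a \<Rightarrow> 'a \<Rightarrow> 'a \<Rightarrow> bool" where
  "is_conormal H \<eta> \<epsilon> J \<longleftrightarrow> (\<epsilon> \<otimes> \<one> H) \<cdot> J = \<eta> \<and> (\<one> H \<otimes> \<epsilon>) \<cdot> J = \<eta>"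

definition twist_comult :: "'o \<Rightarrow> 'a \<Rightarrow> 'a \<Rightarrow> 'a \<Rightarrow> 'a \<Rightarrow> 'a" where
  "twist_comult H \<eta> \<mu> \<delta> J =
     (let \<mu>2 = tensor_mult H \<mu> H \<mu>;
          J' = conv_inverse (H \<odot> H) (\<eta> \<otimes> \<eta>) \<mu>2 J
      in \<mu>2 \<cdot> (\<mu>2 \<otimes> \<one> H \<otimes> \<one> H) \<cdot> (J' \<otimes> \<delta> \<otimes> J))"

end

end

theory Submission
  imports Defs
begin

text \<open>
  Write \<open>Q\<close> for the convolution inverse of the twist \<open>J\<close>, and use Sweedler indices without
  coassociativity, so that \<open>h11 \<otimes> h12 \<otimes> h2\<close> and \<open>h1 \<otimes> h21 \<otimes> h22\<close> are different elements. As for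
  ordinary Hopf algebras, the new coproduct is \<open>Q \<delta>(h) J\<close> and the new antipode is
  \<open>SJ(h) = u' S(h) u\<close> with \<open>u = S(J1) J2\<close> and \<open>u' = Q1 S(Q2)\<close>. What replaces coassociativity is the
  following observation about the iterated coproduct:
  \<open>h11 \<otimes> h12 \<otimes> h2\<close> for \<open>H_J\<close> equals
  \<open>(Q \<otimes> 1) (\<delta> \<otimes> H)(Q) (h11 \<otimes> h12 \<otimes> h2) (\<delta> \<otimes> H)(J) (J \<otimes> 1)\<close>, where the factor in the middle is formed with the original \<open>\<delta>\<close>, and the twist equation, for \<open>J\<close> and for
  \<open>Q\<close>, turns the two outer factors into \<open>(1 \<otimes> Q) (H \<otimes> \<delta>)(Q)\<close> and \<open>(H \<otimes> \<delta>)(J) (1 \<otimes> J)\<close>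
  (\<open>twisted_comult_iterated\<close>).

  The antipode is antimultiplicative (\<open>antipode_antimultiplicative\<close>), so \<open>(a \<otimes> b) z = a z S(b)\<close> is a left
  action and \<open>z (a \<otimes> b) = S(a) z b\<close> a right action of the monoid \<open>H \<otimes> H\<close> on \<open>H\<close>. With a regular
  factor in front they give actions of \<open>H \<otimes> H \<otimes> H\<close> on \<open>H \<otimes> H\<close>, and the left hand sides of the two
  antipode equations \<open>h11 \<otimes> h12 SJ(h2) = h \<otimes> 1\<close> and \<open>h11 \<otimes> SJ(h12) h2 = h \<otimes> 1\<close> are, up to a factor
  \<open>1 \<otimes> u\<close> or \<open>1 \<otimes> u'\<close>, the iterated coproduct acting on \<open>1 \<otimes> u'\<close> or \<open>1 \<otimes> u\<close>. Letting the
  factors act one after the other, each step collapses: \<open>J\<close> meets \<open>Q\<close>, then \<open>J1 \<otimes> J21 S(J22)\<close> is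
  \<open>1 \<otimes> 1\<close> by conormality, then the antipode equation of \<open>H\<close> applies to the middle factor, and
  the same cancellations happen for the remaining factors. What is left is \<open>h \<otimes> u' u\<close>, and
  \<open>u' u = 1\<close> is again a consequence of the twist equation (\<open>u'_u\<close>).

  The other two antipode equations are these two in the category with reversed tensor product: there
  \<open>Q\<close> is a twist with inverse \<open>J\<close>, the roles of \<open>u\<close> and \<open>u'\<close> are exchanged, and both the twisted
  coproduct and \<open>SJ\<close> are the same arrows as before.

  There are no elements in \<open>C\<close>. A product of generalized elements is the convolution
  \<open>conv C p f g\<close> along a pairing \<open>p\<close>; monoid products and actions are both pairings, and one
  associativity lemma for tensor products of pairings (\<open>tensor_pairing_assoc\<close>) contains all
  the permutations of tensor factors that the argument uses.
\<close>

section \<open>Strict symmetric monoidal categories\<close>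

text \<open>
Membership in a hom set leaves the intermediate objects of a composite unknown, which conditional
rewriting cannot guess. The axioms are therefore restated with domains and codomains that the
simplifier can compute; hom sets serve for hypotheses.
\<close>

context category
begin

lemma hom_Arr: "f \<in> hom C X Y \<Longrightarrow> f \<in> Arr C"
  and hom_Dom: "f \<in> hom C X Y \<Longrightarrow> Dom C f = X"
  and hom_Cod: "f \<in> hom C X Y \<Longrightarrow> Cod C f = Y"
  and hom_Obj_dom: "f \<in> hom C X Y \<Longrightarrow> X \<in> Obj C"
  and hom_Obj_cod: "f \<in> hom C X Y \<Longrightarrow> Y \<in> Obj C"
  using Dom_closed Cod_closed by (auto simp: hom_def)

lemma hom_iff: "f \<in> hom C X Y \<longleftrightarrow> f \<in> Arr C \<and> Dom C f = X \<and> Cod C f = Y"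
  by (simp add: hom_def)

lemma ident_simps [simp]:
  assumes "A \<in> Obj C"
  shows "\<one> A \<in> Arr C" "Dom C (\<one> A) = A" "Cod C (\<one> A) = A"
  using ident_closed[OF assms] by (auto simp: hom_def)

lemma cmp_simps [simp]:
  assumes "f \<in> Arr C" "g \<in> Arr C" "Cod C f = Dom C g"
  shows "g \<cdot> f \<in> Arr C" "Dom C (g \<cdot> f) = Dom C f" "Cod C (g \<cdot> f) = Cod C g"
  using cmp_closed[of f "Dom C f" "Dom C g" g "Cod C g"] assms by (auto simp: hom_def)

lemma cmp_ident [simp]:
  "f \<in> Arr C \<Longrightarrow> Dom C f = X \<Longrightarrow> f \<cdot> \<one> X = f"
  "f \<in> Arr C \<Longrightarrow> Cod C f = X \<Longrightarrow> \<one> X \<cdot> f = f"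
  using cmp_ident_left cmp_ident_right by (auto simp: hom_def)

lemma cmp_assoc_Arr:
  "\<lbrakk>f \<in> Arr C; g \<in> Arr C; h \<in> Arr C; Cod C f = Dom C g; Cod C g = Dom C h\<rbrakk>
    \<Longrightarrow> (h \<cdot> g) \<cdot> f = h \<cdot> (g \<cdot> f)"
  using cmp_assoc[of f "Dom C f" "Dom C g" g "Dom C h" h "Cod C h"] by (auto simp: hom_def)

text \<open>Lets an equation for a two-fold composite rewrite inside a right-nested chain of composites.\<close>

lemma cmp_reassoc:
  "\<lbrakk>g \<cdot> f = k; f \<in> Arr C; g \<in> Arr C; x \<in> Arr C; Cod C x = Dom C f; Cod C f = Dom C g\<rbrakk>
    \<Longrightarrow> g \<cdot> (f \<cdot> x) = k \<cdot> x"
  using cmp_assoc_Arr[of x f g] by simp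

declare Dom_closed [simp] Cod_closed [simp]

end

context strict_monoidal_category
begin

declare unit_obj_closed [simp] tensor_obj_closed [simp] tensor_obj_assoc [simp]
  tensor_obj_unit_left [simp] tensor_obj_unit_right [simp]
  tensor_arr_unit_left [simp] tensor_arr_unit_right [simp]

lemma tensor_arr_simps [simp]:
  assumes "f \<in> Arr C" "g \<in> Arr C"
  shows "f \<otimes> g \<in> Arr C" "Dom C (f \<otimes> g) = Dom C f \<odot> Dom C g"
    "Cod C (f \<otimes> g) = Cod C f \<odot> Cod C g"
  using tensor_arr_closed[of f "Dom C f" "Cod C f" g "Dom C g" "Cod C g"] assms
  by (auto simp: hom_def)

lemma interchange_Arr:
  "\<lbrakk>f \<in> Arr C; f' \<in> Arr C; g \<in> Arr C; g' \<in> Arr C; Cod C f = Dom C f'; Cod C g = Dom C g'\<rbrakk>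
    \<Longrightarrow> (f' \<otimes> g') \<cdot> (f \<otimes> g) = (f' \<cdot> f) \<otimes> (g' \<cdot> g)"
  using interchange[of f "Dom C f" "Dom C f'" f' "Cod C f'" g "Dom C g" "Dom C g'" g' "Cod C g'"]
  by (auto simp: hom_def)

end

context strict_symmetric_monoidal_category
begin

lemma symm_simps [simp]:
  assumes "A \<in> Obj C" "B \<in> Obj C"
  shows "\<sigma> A B \<in> Arr C" "Dom C (\<sigma> A B) = A \<odot> B" "Cod C (\<sigma> A B) = B \<odot> A"
  using symm_closed[OF assms] by (auto simp: hom_def)

text \<open>By the hexagon \<open>\<sigma> A \<bbbK>\<close> is idempotent, and an invertible idempotent is the identity.\<close>

lemma symm_unit_right [simp]:
  assumes A: "A \<in> Obj C"
  shows "\<sigma> A \<bbbK> = \<one> A"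
proof -
  have "\<sigma> A \<bbbK> = \<sigma> A \<bbbK> \<cdot> \<sigma> A \<bbbK>"
    using symm_hexagon[of A "\<bbbK>" "\<bbbK>"] A by simp
  then have "\<sigma> \<bbbK> A \<cdot> \<sigma> A \<bbbK> = (\<sigma> \<bbbK> A \<cdot> \<sigma> A \<bbbK>) \<cdot> \<sigma> A \<bbbK>"
    using A by (simp add: cmp_assoc_Arr)
  then show ?thesis using A by (simp add: symm_involutive)
qed

lemma symm_unit_left [simp]:
  assumes A: "A \<in> Obj C"
  shows "\<sigma> \<bbbK> A = \<one> A"
  using symm_involutive[of A "\<bbbK>"] A by simp

text \<open>The inverse of the hexagon for \<open>\<sigma> Z (X \<odot> Y)\<close>.\<close>

lemma symm_hexagon_left:
  assumes [simp]: "X \<in> Obj C" "Y \<in> Obj C" "Z \<in> Obj C"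
  shows "\<sigma> (X \<odot> Y) Z = (\<sigma> X Z \<otimes> \<one> Y) \<cdot> (\<one> X \<otimes> \<sigma> Y Z)" (is "_ = ?R")
proof -
  have "?R \<cdot> \<sigma> Z (X \<odot> Y) = (\<sigma> X Z \<otimes> \<one> Y) \<cdot> ((\<one> X \<otimes> \<sigma> Y Z) \<cdot> (\<one> X \<otimes> \<sigma> Z Y)) \<cdot> (\<sigma> Z X \<otimes> \<one> Y)"
    by (simp add: symm_hexagon cmp_assoc_Arr)
  also have "\<dots> = \<one> (Z \<odot> X \<odot> Y)"
    by (simp add: interchange_Arr symm_involutive tensor_ident)
  finally have "(?R \<cdot> \<sigma> Z (X \<odot> Y)) \<cdot> \<sigma> (X \<odot> Y) Z = \<sigma> (X \<odot> Y) Z"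
    by simp
  then show ?thesis by (simp add: cmp_assoc_Arr symm_involutive)
qed

lemma symm_natural_Arr:
  "f \<in> Arr C \<Longrightarrow> g \<in> Arr C \<Longrightarrow> Cod C f = A' \<Longrightarrow> Cod C g = B' \<Longrightarrow>
    \<sigma> A' B' \<cdot> (f \<otimes> g) = (g \<otimes> f) \<cdot> \<sigma> (Dom C f) (Dom C g)"
  using symm_natural[of f "Dom C f" "Cod C f" g "Dom C g" "Cod C g"] by (simp add: hom_def)

end

section \<open>Tensor products of pairings\<close>

text \<open>
  A pairing is an arrow \<open>p: A \<odot> B \<rightarrow> E\<close>; monoid products and actions on either side are examples. The
  tensor product of two pairings acts factorwise after exchanging the two inner tensor factors.
  With \<open>A = B\<close> and \<open>A' = B'\<close> it is \<open>tensor_mult\<close>; the general form also covers the diagonal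
  actions of \<open>H \<otimes> H \<otimes> H\<close> on \<open>H \<otimes> H\<close>.
\<close>

context
  fixes C :: "('o, 'a, 'm) sm_struct_scheme" (structure)
begin

definition tensor_pairing :: "'o \<Rightarrow> 'o \<Rightarrow> 'o \<Rightarrow> 'o \<Rightarrow> 'a \<Rightarrow> 'a \<Rightarrow> 'a" where
  "tensor_pairing A A' B B' p p' = (p \<otimes> p') \<cdot> (\<one> A \<otimes> \<sigma> A' B \<otimes> \<one> B')"

end

context strict_symmetric_monoidal_category
begin

text \<open>In elements this reads \<open>(f \<otimes> g) (f' \<otimes> g') = f f' \<otimes> g g'\<close>; the symmetry on the right only sorts the
variables of \<open>g\<close> and \<open>f'\<close>.\<close>

lemma tensor_pairing_tensor:
  assumes "p \<in> hom C (A \<odot> B) E" "p' \<in> hom C (A' \<odot> B') E'"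
    and "f \<in> hom C X A" "g \<in> hom C Y A'" "f' \<in> hom C X' B" "g' \<in> hom C Y' B'"
  shows "conv C (tensor_pairing C A A' B B' p p') (f \<otimes> g) (f' \<otimes> g') =
    (conv C p f f' \<otimes> conv C p' g g') \<cdot> (\<one> X \<otimes> \<sigma> Y X' \<otimes> \<one> Y')"
proof -
  note [simp] = assms[THEN hom_Arr] assms[THEN hom_Dom] assms[THEN hom_Cod]
    assms(3-)[THEN hom_Obj_dom] assms(3-)[THEN hom_Obj_cod]
  have "(\<one> A \<otimes> \<sigma> A' B \<otimes> \<one> B') \<cdot> ((f \<otimes> g) \<otimes> (f' \<otimes> g'))
      = (\<one> A \<otimes> (\<sigma> A' B \<otimes> \<one> B')) \<cdot> (f \<otimes> ((g \<otimes> f') \<otimes> g'))"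
    by (simp add: tensor_arr_assoc)
  also have "\<dots> = (f \<otimes> ((f' \<otimes> g) \<otimes> g')) \<cdot> (\<one> X \<otimes> (\<sigma> Y X' \<otimes> \<one> Y'))"
    by (simp add: interchange_Arr symm_natural_Arr)
  also have "\<dots> = ((f \<otimes> f') \<otimes> (g \<otimes> g')) \<cdot> (\<one> X \<otimes> \<sigma> Y X' \<otimes> \<one> Y')"
    by (simp add: tensor_arr_assoc)
  finally show ?thesis
    by (simp add: conv_def tensor_pairing_def cmp_assoc_Arr)
       (simp add: cmp_assoc_Arr[symmetric] interchange_Arr)
qed

lemma whisker_cmp:
  "\<lbrakk>A \<in> Obj C; B \<in> Obj C; f \<in> Arr C; g \<in> Arr C; Cod C f = Dom C g\<rbrakk>
    \<Longrightarrow> \<one> A \<otimes> (g \<cdot> f) \<otimes> \<one> B = (\<one> A \<otimes> g \<otimes> \<one> B) \<cdot> (\<one> A \<otimes> f \<otimes> \<one> B)"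
  "\<lbrakk>A \<in> Obj C; f \<in> Arr C; g \<in> Arr C; Cod C f = Dom C g\<rbrakk>
    \<Longrightarrow> \<one> A \<otimes> (g \<cdot> f) = (\<one> A \<otimes> g) \<cdot> (\<one> A \<otimes> f)"
  "\<lbrakk>B \<in> Obj C; f \<in> Arr C; g \<in> Arr C; Cod C f = Dom C g\<rbrakk>
    \<Longrightarrow> (g \<cdot> f) \<otimes> \<one> B = (g \<otimes> \<one> B) \<cdot> (f \<otimes> \<one> B)"
  by (simp_all add: interchange_Arr)

text \<open>Both sides are the permutation \<open>A \<odot> B \<odot> X \<odot> Y \<rightarrow> B \<odot> Y \<odot> A \<odot> X\<close>. Expanded by the hexagons, the two differ only
in the order of two exchanges of disjoint neighbouring factors.\<close>

lemma symm_shuffle_assoc: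
  assumes [simp]: "A \<in> Obj C" "B \<in> Obj C" "X \<in> Obj C" "Y \<in> Obj C"
  shows "(\<one> B \<otimes> \<sigma> (A \<odot> X) Y) \<cdot> (\<sigma> A B \<otimes> \<one> (X \<odot> Y))
     = (\<sigma> A (B \<odot> Y) \<otimes> \<one> X) \<cdot> (\<one> (A \<odot> B) \<otimes> \<sigma> X Y)"
proof -
  have *: "(\<one> (B \<odot> A) \<otimes> \<sigma> X Y) \<cdot> (\<sigma> A B \<otimes> \<one> (X \<odot> Y))
      = (\<sigma> A B \<otimes> \<one> (Y \<odot> X)) \<cdot> (\<one> (A \<odot> B) \<otimes> \<sigma> X Y)"
    by (simp add: interchange_Arr)
  have "(\<one> B \<otimes> \<sigma> (A \<odot> X) Y) \<cdot> (\<sigma> A B \<otimes> \<one> (X \<odot> Y))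
     = (\<one> B \<otimes> \<sigma> A Y \<otimes> \<one> X) \<cdot> ((\<one> (B \<odot> A) \<otimes> \<sigma> X Y) \<cdot> (\<sigma> A B \<otimes> \<one> (X \<odot> Y)))"
    by (simp add: symm_hexagon_left whisker_cmp cmp_assoc_Arr tensor_arr_assoc
        flip: tensor_ident)
  also have "\<dots> = (\<sigma> A (B \<odot> Y) \<otimes> \<one> X) \<cdot> (\<one> (A \<odot> B) \<otimes> \<sigma> X Y)"
    unfolding * by (simp add: symm_hexagon whisker_cmp cmp_assoc_Arr tensor_arr_assoc
        flip: tensor_ident)
  finally show ?thesis .
qed

text \<open>Associativity is stated for four different pairings so that monoids, left actions and right
actions are all instances. After naturality has moved the pairings to the left of all symmetries,
what remains is the coincidence of two permutations.\<close>

lemma tensor_pairing_assoc: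
  assumes q: "q \<in> hom C (A \<odot> B) E" "q' \<in> hom C (A' \<odot> B') E'"
    and s: "s \<in> hom C (B \<odot> Z) F" "s' \<in> hom C (B' \<odot> Z') F'"
    and p: "p \<in> hom C (E \<odot> Z) G" "p' \<in> hom C (E' \<odot> Z') G'"
    and r: "r \<in> hom C (A \<odot> F) G" "r' \<in> hom C (A' \<odot> F') G'"
    and obj[simp]: "A \<in> Obj C" "B \<in> Obj C" "Z \<in> Obj C" "A' \<in> Obj C" "B' \<in> Obj C" "Z' \<in> Obj C"
    and assoc: "p \<cdot> (q \<otimes> \<one> Z) = r \<cdot> (\<one> A \<otimes> s)" "p' \<cdot> (q' \<otimes> \<one> Z') = r' \<cdot> (\<one> A' \<otimes> s')"
  shows "tensor_pairing C E E' Z Z' p p' \<cdot> (tensor_pairing C A A' B B' q q' \<otimes> \<one> (Z \<odot> Z')) =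
    tensor_pairing C A A' F F' r r' \<cdot> (\<one> (A \<odot> A') \<otimes> tensor_pairing C B B' Z Z' s s')"
proof -
  note hs = q s p r
  note [simp] = hs[THEN hom_Arr] hs[THEN hom_Dom] hs[THEN hom_Cod] hs[THEN hom_Obj_cod]
  have "tensor_pairing C E E' Z Z' p p' \<cdot> (tensor_pairing C A A' B B' q q' \<otimes> \<one> (Z \<odot> Z'))
     = conv C (tensor_pairing C E E' Z Z' p p') (q \<otimes> q') (\<one> Z \<otimes> \<one> Z')
        \<cdot> ((\<one> A \<otimes> \<sigma> A' B \<otimes> \<one> B') \<otimes> \<one> (Z \<odot> Z'))"
    by (simp add: conv_def tensor_pairing_def cmp_assoc_Arr interchange_Arr tensor_ident)
  also have "\<dots> = ((p \<cdot> (q \<otimes> \<one> Z)) \<otimes> (p' \<cdot> (q' \<otimes> \<one> Z'))) \<cdot>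
       (\<one> (A \<odot> B) \<otimes> \<sigma> (A' \<odot> B') Z \<otimes> \<one> Z') \<cdot> ((\<one> A \<otimes> \<sigma> A' B \<otimes> \<one> B') \<otimes> \<one> (Z \<odot> Z'))"
    by (subst tensor_pairing_tensor[OF p q ident_closed ident_closed])
       (simp_all add: conv_def cmp_assoc_Arr)
  also have "(\<one> (A \<odot> B) \<otimes> \<sigma> (A' \<odot> B') Z \<otimes> \<one> Z') \<cdot> ((\<one> A \<otimes> \<sigma> A' B \<otimes> \<one> B') \<otimes> \<one> (Z \<odot> Z'))
    = \<one> A \<otimes> ((\<one> B \<otimes> \<sigma> (A' \<odot> B') Z) \<cdot> (\<sigma> A' B \<otimes> \<one> (B' \<odot> Z))) \<otimes> \<one> Z'"
    by (simp add: whisker_cmp tensor_arr_assoc flip: tensor_ident)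
  also have "\<dots> = (\<one> A \<otimes> \<sigma> A' (B \<odot> Z) \<otimes> \<one> (B' \<odot> Z')) \<cdot> (\<one> (A \<odot> A') \<otimes> (\<one> B \<otimes> \<sigma> B' Z \<otimes> \<one> Z'))"
    unfolding symm_shuffle_assoc[OF obj(4,2,5,3)]
    by (simp add: whisker_cmp tensor_arr_assoc flip: tensor_ident)
  also have "((p \<cdot> (q \<otimes> \<one> Z)) \<otimes> (p' \<cdot> (q' \<otimes> \<one> Z'))) \<cdot> \<dots>
     = conv C (tensor_pairing C A A' F F' r r') (\<one> A \<otimes> \<one> A') (s \<otimes> s') 
        \<cdot> (\<one> (A \<odot> A') \<otimes> (\<one> B \<otimes> \<sigma> B' Z \<otimes> \<one> Z'))"
    by (subst tensor_pairing_tensor[OF r ident_closed ident_closed s])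
       (simp_all add: conv_def cmp_assoc_Arr assoc)
  also have "\<dots> = tensor_pairing C A A' F F' r r' \<cdot> (\<one> (A \<odot> A') \<otimes> tensor_pairing C B B' Z Z' s s')"
    by (simp add: conv_def tensor_pairing_def cmp_assoc_Arr interchange_Arr tensor_ident)
  finally show ?thesis .
qed

text \<open>The triple tensor product occurs in both bracketings: \<open>tensor_mult\<close> of the twist equation brackets
to the left, while the actions below split off the first factor.\<close>

lemma tensor_pairing_coherence:
  assumes p: "p \<in> hom C (A \<odot> B) E" "p' \<in> hom C (A' \<odot> B') E'" "p'' \<in> hom C (A'' \<odot> B'') E''"
    and obj[simp]: "A \<in> Obj C" "B \<in> Obj C" "A' \<in> Obj C" "B' \<in> Obj C" "A'' \<in> Obj C" "B'' \<in> Obj C"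
  shows "tensor_pairing C (A \<odot> A') A'' (B \<odot> B') B'' (tensor_pairing C A A' B B' p p') p'' =
    tensor_pairing C A (A' \<odot> A'') B (B' \<odot> B'') p (tensor_pairing C A' A'' B' B'' p' p'')"
proof -
  note [simp] = p[THEN hom_Arr] p[THEN hom_Dom] p[THEN hom_Cod] p[THEN hom_Obj_cod]
  have "tensor_pairing C (A \<odot> A') A'' (B \<odot> B') B'' (tensor_pairing C A A' B B' p p') p''
     = (p \<otimes> p' \<otimes> p'') \<cdot> ((\<one> A \<otimes> \<sigma> A' B \<otimes> \<one> (B' \<odot> A'' \<odot> B''))
        \<cdot> (\<one> (A \<odot> A' \<odot> B) \<otimes> \<sigma> A'' B' \<otimes> \<one> B'')) \<cdot> (\<one> (A \<odot> A') \<otimes> \<sigma> A'' B \<otimes> \<one> (B' \<odot> B''))"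
  proof -
    have "((p \<otimes> p') \<cdot> (\<one> A \<otimes> \<sigma> A' B \<otimes> \<one> B')) \<otimes> p''
      = ((p \<otimes> p') \<otimes> p'') \<cdot> ((\<one> A \<otimes> \<sigma> A' B \<otimes> \<one> B') \<otimes> \<one> (A'' \<odot> B''))"
      by (simp add: interchange_Arr)
    then show ?thesis
      by (simp add: tensor_pairing_def symm_hexagon whisker_cmp cmp_assoc_Arr tensor_arr_assoc
          flip: tensor_ident)
  qed
  also have "(\<one> A \<otimes> \<sigma> A' B \<otimes> \<one> (B' \<odot> A'' \<odot> B'')) \<cdot> (\<one> (A \<odot> A' \<odot> B) \<otimes> \<sigma> A'' B' \<otimes> \<one> B'')
      = \<one> A \<otimes> ((\<sigma> A' B \<otimes> \<one> (B' \<odot> A'')) \<cdot> (\<one> (A' \<odot> B) \<otimes> \<sigma> A'' B')) \<otimes> \<one> B''"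
    by (simp add: whisker_cmp tensor_arr_assoc flip: tensor_ident)
  also have "(\<sigma> A' B \<otimes> \<one> (B' \<odot> A'')) \<cdot> (\<one> (A' \<odot> B) \<otimes> \<sigma> A'' B')
      = (\<one> (B \<odot> A') \<otimes> \<sigma> A'' B') \<cdot> (\<sigma> A' B \<otimes> \<one> (A'' \<odot> B'))"
    by (simp add: interchange_Arr)
  also have "(p \<otimes> p' \<otimes> p'') \<cdot> (\<one> A \<otimes> \<dots> \<otimes> \<one> B'') \<cdot> (\<one> (A \<odot> A') \<otimes> \<sigma> A'' B \<otimes> \<one> (B' \<odot> B''))
     = tensor_pairing C A (A' \<odot> A'') B (B' \<odot> B'') p (tensor_pairing C A' A'' B' B'' p' p'')"
  proof -
    have "p \<otimes> ((p' \<otimes> p'') \<cdot> (\<one> A' \<otimes> \<sigma> A'' B' \<otimes> \<one> B''))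
      = (p \<otimes> (p' \<otimes> p'')) \<cdot> (\<one> (A \<odot> B) \<otimes> (\<one> A' \<otimes> \<sigma> A'' B' \<otimes> \<one> B''))"
      by (simp add: interchange_Arr)
    then show ?thesis
      by (simp add: tensor_pairing_def symm_hexagon_left whisker_cmp cmp_assoc_Arr)
        (simp add: whisker_cmp cmp_assoc_Arr tensor_arr_assoc flip: tensor_ident)
  qed
  finally show ?thesis .
qed

lemma tensor_pairing_simps [simp]:
  assumes "p \<in> Arr C" "p' \<in> Arr C" "Dom C p = A \<odot> B" "Dom C p' = A' \<odot> B'"
    and "A \<in> Obj C" "B \<in> Obj C" "A' \<in> Obj C" "B' \<in> Obj C"
  shows "tensor_pairing C A A' B B' p p' \<in> Arr C"
    "Dom C (tensor_pairing C A A' B B' p p') = A \<odot> A' \<odot> B \<odot> B'"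
    "Cod C (tensor_pairing C A A' B B' p p') = Cod C p \<odot> Cod C p'"
  using assms by (simp_all add: tensor_pairing_def)

text \<open>If \<open>g\<close> or \<open>f'\<close> is a constant, there are no variables to be exchanged.\<close>

lemma tensor_pairing_tensor_unit:
  assumes p: "p \<in> hom C (A \<odot> B) E" "p' \<in> hom C (A' \<odot> B') E'"
    and f: "f \<in> Arr C" "Cod C f = A" "g \<in> Arr C" "Cod C g = A'"
      "f' \<in> Arr C" "Cod C f' = B" "g' \<in> Arr C" "Cod C g' = B'"
    and K: "Dom C g = \<bbbK> \<or> Dom C f' = \<bbbK>"
  shows "conv C (tensor_pairing C A A' B B' p p') (f \<otimes> g) (f' \<otimes> g') = conv C p f f' \<otimes> conv C p' g g'"
proof -
  have o: "A \<in> Obj C" "B \<in> Obj C" "A' \<in> Obj C" "B' \<in> Obj C" using f Cod_closed by auto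
  note [simp] = f p[THEN hom_Arr] p[THEN hom_Dom] o
  have "\<one> (Dom C f) \<otimes> \<sigma> (Dom C g) (Dom C f') \<otimes> \<one> (Dom C g') = \<one> (Dom C f \<odot> Dom C f' \<odot> Dom C g \<odot> Dom C g')"
    using K by (auto simp: tensor_ident)
  then show ?thesis
    by (subst tensor_pairing_tensor[OF p, of f "Dom C f" g "Dom C g" f' "Dom C f'" g' "Dom C g'"])
      (simp_all add: hom_iff conv_def)
qed

lemma tensor_pairing_morphism:
  assumes p: "p \<in> hom C (A \<odot> B) E" "p' \<in> hom C (A' \<odot> B') E'"
    and q: "q \<in> hom C (D \<odot> F) G" "q' \<in> hom C (D' \<odot> F') G'"
    and h: "f \<in> hom C A D" "g \<in> hom C B F" "h \<in> hom C E G"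
      "f' \<in> hom C A' D'" "g' \<in> hom C B' F'" "h' \<in> hom C E' G'"
    and m: "h \<cdot> p = q \<cdot> (f \<otimes> g)" "h' \<cdot> p' = q' \<cdot> (f' \<otimes> g')"
  shows "(h \<otimes> h') \<cdot> tensor_pairing C A A' B B' p p' =
     tensor_pairing C D D' F F' q q' \<cdot> ((f \<otimes> f') \<otimes> (g \<otimes> g'))"
proof -
  note hs = p q h
  note [simp] = hs[THEN hom_Arr] hs[THEN hom_Dom] hs[THEN hom_Cod] h[THEN hom_Obj_dom] h[THEN hom_Obj_cod]
  have "tensor_pairing C D D' F F' q q' \<cdot> ((f \<otimes> f') \<otimes> (g \<otimes> g'))
     = ((h \<cdot> p) \<otimes> (h' \<cdot> p')) \<cdot> (\<one> A \<otimes> \<sigma> A' B \<otimes> \<one> B')"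
    using tensor_pairing_tensor[OF q h(1,4,2,5)] by (simp add: conv_def m)
  then show ?thesis
    by (simp add: tensor_pairing_def cmp_assoc_Arr flip: interchange_Arr)
qed

section \<open>Convolution along a pairing\<close>

lemma conv_simps [simp]:
  assumes "p \<in> Arr C" "f \<in> Arr C" "g \<in> Arr C" "Dom C p = Cod C f \<odot> Cod C g"
  shows "conv C p f g \<in> Arr C" "Dom C (conv C p f g) = Dom C f \<odot> Dom C g"
    "Cod C (conv C p f g) = Cod C p"
  using assms by (simp_all add: conv_def)

lemma conv_cmp:
  assumes "p \<in> Arr C" "f \<in> Arr C" "g \<in> Arr C" "Dom C p = Cod C f \<odot> Cod C g"
    and "x \<in> Arr C" "Cod C x = Dom C f" "y \<in> Arr C" "Cod C y = Dom C g"
  shows "conv C p (f \<cdot> x) (g \<cdot> y) = conv C p f g \<cdot> (x \<otimes> y)"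
  using assms by (simp add: conv_def cmp_assoc_Arr interchange_Arr)

lemma conv_cmp_left:
  assumes "p \<in> Arr C" "f \<in> Arr C" "g \<in> Arr C" "Dom C p = Cod C f \<odot> Cod C g"
    and "x \<in> Arr C" "Cod C x = Dom C f"
  shows "conv C p (f \<cdot> x) g = conv C p f g \<cdot> (x \<otimes> \<one> (Dom C g))"
  using conv_cmp[of p f g x "\<one> (Dom C g)"] assms by simp

lemma conv_cmp_right:
  assumes "p \<in> Arr C" "f \<in> Arr C" "g \<in> Arr C" "Dom C p = Cod C f \<odot> Cod C g"
    and "y \<in> Arr C" "Cod C y = Dom C g"
  shows "conv C p f (g \<cdot> y) = conv C p f g \<cdot> (\<one> (Dom C f) \<otimes> y)"
  using conv_cmp[of p f g "\<one> (Dom C f)" y] assms by simp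

text \<open>The hypothesis \<open>p (q \<otimes> Z) = r (A \<otimes> s)\<close> is the one of \<open>tensor_pairing_assoc\<close>, so this applies to
products and to both kinds of actions alike.\<close>

lemma conv_assoc:
  assumes "p \<cdot> (q \<otimes> \<one> Z) = r \<cdot> (\<one> A \<otimes> s)"
    and "q \<in> hom C (A \<odot> B) E" "s \<in> hom C (B \<odot> Z) F" "p \<in> hom C (E \<odot> Z) G" "r \<in> hom C (A \<odot> F) G"
    and "f \<in> Arr C" "Cod C f = A" "g \<in> Arr C" "Cod C g = B" "h \<in> Arr C" "Cod C h = Z"
  shows "conv C p (conv C q f g) h = conv C r f (conv C s g h)"
proof -
  note [simp] = assms(2-5)[THEN hom_Arr] assms(2-5)[THEN hom_Dom] assms(2-5)[THEN hom_Cod] assms(6-)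
  have o[simp]: "A \<in> Obj C" "B \<in> Obj C" "Z \<in> Obj C"
    using assms(6,8,10)[THEN Cod_closed] by simp_all
  have "conv C p (conv C q f g) h = (p \<cdot> (q \<otimes> \<one> Z)) \<cdot> ((f \<otimes> g) \<otimes> h)"
    by (simp add: conv_def cmp_assoc_Arr interchange_Arr)
  also have "\<dots> = r \<cdot> (\<one> A \<otimes> s) \<cdot> (f \<otimes> (g \<otimes> h))"
    unfolding assms(1) by (simp add: cmp_assoc_Arr tensor_arr_assoc)
  also have "\<dots> = conv C r f (conv C s g h)"
    by (simp add: conv_def interchange_Arr)
  finally show ?thesis .
qed

lemma monoid_hom:
  assumes "is_monoid C A \<eta> \<mu>"
  shows "A \<in> Obj C" "\<eta> \<in> hom C \<bbbK> A" "\<mu> \<in> hom C (A \<odot> A) A"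
  using assms by (simp_all add: is_monoid_def)

lemma monoid_conv:
  assumes m: "is_monoid C A \<eta> \<mu>" and f[simp]: "f \<in> Arr C" "Cod C f = A"
  shows monoid_conv_unit_left: "conv C \<mu> \<eta> f = f"
    and monoid_conv_unit_right: "conv C \<mu> f \<eta> = f"
    and monoid_conv_assoc: "\<lbrakk>g \<in> Arr C; Cod C g = A; h \<in> Arr C; Cod C h = A\<rbrakk>
      \<Longrightarrow> conv C \<mu> (conv C \<mu> f g) h = conv C \<mu> f (conv C \<mu> g h)"
proof -
  note hs = monoid_hom[OF m]
  note [simp] = hs(1) hs(2,3)[THEN hom_Arr] hs(2,3)[THEN hom_Dom] hs(2,3)[THEN hom_Cod]
  have "conv C \<mu> \<eta> f = (\<mu> \<cdot> (\<eta> \<otimes> \<one> A)) \<cdot> f"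
    using conv_cmp_right[of \<mu> \<eta> "\<one> A" f] by (simp add: conv_def)
  then show "conv C \<mu> \<eta> f = f" using m by (simp add: is_monoid_def)
  have "conv C \<mu> f \<eta> = (\<mu> \<cdot> (\<one> A \<otimes> \<eta>)) \<cdot> f"
    using conv_cmp_left[of \<mu> "\<one> A" \<eta> f] by (simp add: conv_def)
  then show "conv C \<mu> f \<eta> = f" using m by (simp add: is_monoid_def)
  show "\<lbrakk>g \<in> Arr C; Cod C g = A; h \<in> Arr C; Cod C h = A\<rbrakk>
      \<Longrightarrow> conv C \<mu> (conv C \<mu> f g) h = conv C \<mu> f (conv C \<mu> g h)"
    by (rule conv_assoc[where A = A and B = A and Z = A and E = A and F = A and G = A])
      (use m in \<open>simp_all add: is_monoid_def\<close>)
qed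

lemma tensor_monoid:
  assumes m: "is_monoid C A \<eta> \<mu>" and m': "is_monoid C A' \<eta>' \<mu>'"
  shows "is_monoid C (A \<odot> A') (\<eta> \<otimes> \<eta>') (tensor_pairing C A A' A A' \<mu> \<mu>')"
proof -
  note hs = monoid_hom[OF m] monoid_hom[OF m']
  note [simp] = hs(1,4) hs(2,3,5,6)[THEN hom_Arr] hs(2,3,5,6)[THEN hom_Dom] hs(2,3,5,6)[THEN hom_Cod]
  have l: "conv C (tensor_pairing C A A' A A' \<mu> \<mu>') (\<eta> \<otimes> \<eta>') (\<one> A \<otimes> \<one> A') = \<one> (A \<odot> A')"
    by (subst tensor_pairing_tensor_unit[OF hs(3,6)])
      (simp_all add: monoid_conv_unit_left[OF m] monoid_conv_unit_left[OF m'] tensor_ident)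
  have r: "conv C (tensor_pairing C A A' A A' \<mu> \<mu>') (\<one> A \<otimes> \<one> A') (\<eta> \<otimes> \<eta>') = \<one> (A \<odot> A')"
    by (subst tensor_pairing_tensor_unit[OF hs(3,6)])
      (simp_all add: monoid_conv_unit_right[OF m] monoid_conv_unit_right[OF m'] tensor_ident)
  have a: "tensor_pairing C A A' A A' \<mu> \<mu>' \<cdot> (tensor_pairing C A A' A A' \<mu> \<mu>' \<otimes> \<one> (A \<odot> A')) =
    tensor_pairing C A A' A A' \<mu> \<mu>' \<cdot> (\<one> (A \<odot> A') \<otimes> tensor_pairing C A A' A A' \<mu> \<mu>')"
    by (rule tensor_pairing_assoc[OF hs(3,6) hs(3,6) hs(3,6) hs(3,6)])
      (use m m' in \<open>simp_all add: is_monoid_def\<close>)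
  show ?thesis
    using l r a by (simp add: is_monoid_def hom_iff conv_def tensor_ident)
qed

end

section \<open>Hopf coquasigroups and their antipode\<close>

locale hopf_coquasigroup = strict_symmetric_monoidal_category C
  for C :: "('o, 'a, 'm) sm_struct_scheme" (structure) +
  fixes H :: 'o and \<eta> \<mu> \<epsilon> \<delta> S :: 'a
  assumes bimonoid: "is_noncoassociative_bimonoid C H \<eta> \<mu> \<epsilon> \<delta>"
    and antipode: "is_antipode C H \<eta> \<mu> \<delta> S"
begin

lemma monoid1: "is_monoid C H \<eta> \<mu>" and comagma: "is_counital_comagma C H \<epsilon> \<delta>"
  using bimonoid by (simp_all add: is_noncoassociative_bimonoid_def)

lemma H_hom: "\<eta> \<in> hom C \<bbbK> H" "\<mu> \<in> hom C (H \<odot> H) H" "\<epsilon> \<in> hom C H \<bbbK>"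
  "\<delta> \<in> hom C H (H \<odot> H)" "S \<in> hom C H H"
  using monoid1 comagma antipode
  by (simp_all add: is_monoid_def is_counital_comagma_def is_antipode_def)

lemmas H_simps [simp] = monoid_hom(1)[OF monoid1] H_hom[THEN hom_Arr] H_hom[THEN hom_Dom] H_hom[THEN hom_Cod]

lemma H_eqs [simp]: "\<epsilon> \<cdot> \<eta> = \<one> \<bbbK>" "\<delta> \<cdot> \<eta> = \<eta> \<otimes> \<eta>" "\<epsilon> \<cdot> \<mu> = \<epsilon> \<otimes> \<epsilon>"
  "(\<epsilon> \<otimes> \<one> H) \<cdot> \<delta> = \<one> H" "(\<one> H \<otimes> \<epsilon>) \<cdot> \<delta> = \<one> H"
  using bimonoid by (simp_all add: is_noncoassociative_bimonoid_def is_counital_comagma_def)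

definition \<mu>2 where "\<mu>2 = tensor_pairing C H H H H \<mu> \<mu>"
definition \<mu>3 where "\<mu>3 = tensor_pairing C H (H \<odot> H) H (H \<odot> H) \<mu> \<mu>2"

abbreviation conv1 (infixl "\<star>\<^sub>1" 75) where "conv1 \<equiv> conv C \<mu>"
abbreviation conv2 (infixl "\<star>\<^sub>2" 75) where "conv2 \<equiv> conv C \<mu>2"
abbreviation conv3 (infixl "\<star>\<^sub>3" 75) where "conv3 \<equiv> conv C \<mu>3"

lemma \<mu>2_simps [simp]: "\<mu>2 \<in> Arr C" "Dom C \<mu>2 = H \<odot> (H \<odot> (H \<odot> H))" "Cod C \<mu>2 = H \<odot> H"
  by (simp_all add: \<mu>2_def)

lemma \<mu>3_simps [simp]: "\<mu>3 \<in> Arr C" "Dom C \<mu>3 = H \<odot> (H \<odot> (H \<odot> (H \<odot> (H \<odot> H))))"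
  "Cod C \<mu>3 = H \<odot> (H \<odot> H)"
  by (simp_all add: \<mu>3_def)

lemma \<mu>2_tensor_mult: "\<mu>2 = tensor_mult C H \<mu> H \<mu>"
  by (simp add: \<mu>2_def tensor_mult_def tensor_pairing_def)

lemma \<mu>2_hom: "\<mu>2 \<in> hom C (H \<odot> H \<odot> (H \<odot> H)) (H \<odot> H)"
  by (simp add: hom_iff)

lemma \<mu>3_coherence: "\<mu>3 = tensor_pairing C (H \<odot> H) H (H \<odot> H) H \<mu>2 \<mu>"
  using tensor_pairing_coherence[OF H_hom(2) H_hom(2) H_hom(2)] by (simp add: \<mu>3_def \<mu>2_def)

lemma monoid2: "is_monoid C (H \<odot> H) (\<eta> \<otimes> \<eta>) \<mu>2"
  using tensor_monoid[OF monoid1 monoid1] by (simp add: \<mu>2_def)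

lemma monoid3: "is_monoid C (H \<odot> (H \<odot> H)) (\<eta> \<otimes> (\<eta> \<otimes> \<eta>)) \<mu>3"
  using tensor_monoid[OF monoid1 monoid2] by (simp add: \<mu>3_def)

lemmas conv_units [simp] =
  monoid_conv_unit_left[OF monoid1] monoid_conv_unit_right[OF monoid1]
  monoid_conv_unit_left[OF monoid2] monoid_conv_unit_right[OF monoid2]
  monoid_conv_unit_left[OF monoid3] monoid_conv_unit_right[OF monoid3]

lemmas conv_assocs = monoid_conv_assoc[OF monoid1] monoid_conv_assoc[OF monoid2] monoid_conv_assoc[OF monoid3]

lemmas conv2_tensor = tensor_pairing_tensor_unit[OF H_hom(2) H_hom(2), folded \<mu>2_def]
lemmas conv3_tensor = tensor_pairing_tensor_unit[OF H_hom(2) \<mu>2_hom, folded \<mu>3_def]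
lemmas conv3_tensor' = tensor_pairing_tensor_unit[OF \<mu>2_hom H_hom(2), folded \<mu>3_coherence]

lemma comult_mult: "\<delta> \<cdot> \<mu> = \<mu>2 \<cdot> (\<delta> \<otimes> \<delta>)"
  using bimonoid by (simp add: is_noncoassociative_bimonoid_def \<mu>2_tensor_mult)

text \<open>Tensor products of multiplicative arrows are multiplicative, for the tensor products of the
respective pairings. In the last two cases one factor of the target is the unit object, with its
trivial product \<open>\<one> \<bbbK>\<close>.\<close>

lemma comult_tensor_mult:
  shows "(\<delta> \<otimes> \<one> H) \<cdot> \<mu>2 = \<mu>3 \<cdot> ((\<delta> \<otimes> \<one> H) \<otimes> (\<delta> \<otimes> \<one> H))"
    and "(\<one> H \<otimes> \<delta>) \<cdot> \<mu>2 = \<mu>3 \<cdot> ((\<one> H \<otimes> \<delta>) \<otimes> (\<one> H \<otimes> \<delta>))"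
    and "(\<epsilon> \<otimes> \<one> H) \<cdot> \<mu>2 = \<mu> \<cdot> ((\<epsilon> \<otimes> \<one> H) \<otimes> (\<epsilon> \<otimes> \<one> H))"
    and "(\<one> H \<otimes> \<epsilon>) \<cdot> \<mu>2 = \<mu> \<cdot> ((\<one> H \<otimes> \<epsilon>) \<otimes> (\<one> H \<otimes> \<epsilon>))"
proof -
  have i: "\<mu> \<cdot> (\<one> H \<otimes> \<one> H) = \<mu>" by (simp add: tensor_ident)
  have K: "\<one> \<bbbK> \<in> hom C (\<bbbK> \<odot> \<bbbK>) \<bbbK>" by (simp add: hom_iff)
  have 1: "\<epsilon> \<cdot> \<mu> = \<one> \<bbbK> \<cdot> (\<epsilon> \<otimes> \<epsilon>)" by simp
  note I = ident_closed[OF H_simps(1)]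
  show "(\<delta> \<otimes> \<one> H) \<cdot> \<mu>2 = \<mu>3 \<cdot> ((\<delta> \<otimes> \<one> H) \<otimes> (\<delta> \<otimes> \<one> H))"
    unfolding \<mu>3_coherence
    by (subst (1) \<mu>2_def, rule tensor_pairing_morphism[OF H_hom(2) H_hom(2) \<mu>2_hom H_hom(2) H_hom(4) H_hom(4) H_hom(4) I I I])
      (simp_all add: comult_mult i)
  show "(\<one> H \<otimes> \<delta>) \<cdot> \<mu>2 = \<mu>3 \<cdot> ((\<one> H \<otimes> \<delta>) \<otimes> (\<one> H \<otimes> \<delta>))"
    unfolding \<mu>3_def
    by (subst (1) \<mu>2_def, rule tensor_pairing_morphism[OF H_hom(2) H_hom(2) H_hom(2) \<mu>2_hom I I I H_hom(4) H_hom(4) H_hom(4)])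
      (simp_all add: comult_mult i)
  show "(\<epsilon> \<otimes> \<one> H) \<cdot> \<mu>2 = \<mu> \<cdot> ((\<epsilon> \<otimes> \<one> H) \<otimes> (\<epsilon> \<otimes> \<one> H))"
    using tensor_pairing_morphism[OF H_hom(2) H_hom(2) K H_hom(2) H_hom(3) H_hom(3) H_hom(3) I I I 1]
    by (simp add: i \<mu>2_def) (simp add: tensor_pairing_def tensor_ident)
  show "(\<one> H \<otimes> \<epsilon>) \<cdot> \<mu>2 = \<mu> \<cdot> ((\<one> H \<otimes> \<epsilon>) \<otimes> (\<one> H \<otimes> \<epsilon>))"
    using tensor_pairing_morphism[OF H_hom(2) H_hom(2) H_hom(2) K I I I H_hom(3) H_hom(3) H_hom(3) _ 1]
    by (simp add: i \<mu>2_def) (simp add: tensor_pairing_def tensor_ident)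
qed

lemma morphism_conv:
  assumes m: "h \<cdot> p = q \<cdot> (h \<otimes> h)"
    and [simp]: "h \<in> Arr C" "p \<in> Arr C" "q \<in> Arr C" "Cod C p = Dom C h"
      "Dom C p = Dom C h \<odot> Dom C h" "Dom C q = Cod C h \<odot> Cod C h"
      "x \<in> Arr C" "y \<in> Arr C" "Cod C x = Dom C h" "Cod C y = Dom C h"
  shows "h \<cdot> conv C p x y = conv C q (h \<cdot> x) (h \<cdot> y)"
proof -
  have "h \<cdot> conv C p x y = (h \<cdot> p) \<cdot> (x \<otimes> y)" by (simp add: conv_def cmp_assoc_Arr)
  then show ?thesis unfolding m by (simp add: conv_cmp) (simp add: conv_def cmp_assoc_Arr)
qed

lemma comult_conv:
  shows "\<lbrakk>x \<in> Arr C; Cod C x = H; y \<in> Arr C; Cod C y = H\<rbrakk> \<Longrightarrow> \<delta> \<cdot> x \<star>\<^sub>1 y = (\<delta> \<cdot> x) \<star>\<^sub>2 (\<delta> \<cdot> y)"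
    and "\<lbrakk>x \<in> Arr C; Cod C x = H \<odot> H; y \<in> Arr C; Cod C y = H \<odot> H\<rbrakk>
      \<Longrightarrow> (\<delta> \<otimes> \<one> H) \<cdot> x \<star>\<^sub>2 y = ((\<delta> \<otimes> \<one> H) \<cdot> x) \<star>\<^sub>3 ((\<delta> \<otimes> \<one> H) \<cdot> y)"
    and "\<lbrakk>x \<in> Arr C; Cod C x = H \<odot> H; y \<in> Arr C; Cod C y = H \<odot> H\<rbrakk>
      \<Longrightarrow> (\<one> H \<otimes> \<delta>) \<cdot> x \<star>\<^sub>2 y = ((\<one> H \<otimes> \<delta>) \<cdot> x) \<star>\<^sub>3 ((\<one> H \<otimes> \<delta>) \<cdot> y)"
    and "\<lbrakk>x \<in> Arr C; Cod C x = H \<odot> H; y \<in> Arr C; Cod C y = H \<odot> H\<rbrakk>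
      \<Longrightarrow> (\<epsilon> \<otimes> \<one> H) \<cdot> x \<star>\<^sub>2 y = ((\<epsilon> \<otimes> \<one> H) \<cdot> x) \<star>\<^sub>1 ((\<epsilon> \<otimes> \<one> H) \<cdot> y)"
    and "\<lbrakk>x \<in> Arr C; Cod C x = H \<odot> H; y \<in> Arr C; Cod C y = H \<odot> H\<rbrakk>
      \<Longrightarrow> (\<one> H \<otimes> \<epsilon>) \<cdot> x \<star>\<^sub>2 y = ((\<one> H \<otimes> \<epsilon>) \<cdot> x) \<star>\<^sub>1 ((\<one> H \<otimes> \<epsilon>) \<cdot> y)"
  by (rule morphism_conv; simp add: comult_mult comult_tensor_mult)+

definition "mult_S_right = \<mu> \<cdot> (\<one> H \<otimes> S)"
definition "mult_S_left = \<mu> \<cdot> (S \<otimes> \<one> H)"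

lemma mult_S_right_simps [simp]: "mult_S_right \<in> Arr C" "Dom C mult_S_right = H \<odot> H" "Cod C mult_S_right = H"
  and mult_S_left_simps [simp]: "mult_S_left \<in> Arr C" "Dom C mult_S_left = H \<odot> H" "Cod C mult_S_left = H"
  by (simp_all add: mult_S_right_def mult_S_left_def)

text \<open>Brings both antipode equations on the right, for an arbitrary comultiplication \<open>d\<close> and antipode \<open>s\<close>,
into the form of an arrow \<open>\<one> H \<otimes> t\<close> applied to the iterated coproduct \<open>(d \<otimes> \<one> H) \<cdot> d\<close>.\<close>

lemma whiskered_mult:
  assumes [simp]: "d \<in> Arr C" "Dom C d = H" "Cod C d = H \<odot> H" "s \<in> Arr C" "Dom C s = H" "Cod C s = H"
  shows "(\<one> H \<otimes> \<mu>) \<cdot> (d \<otimes> s) = (\<one> H \<otimes> (\<one> H \<star>\<^sub>1 s)) \<cdot> (d \<otimes> \<one> H)"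
    and "(\<one> H \<otimes> \<mu>) \<cdot> (((\<one> H \<otimes> s) \<cdot> d) \<otimes> \<one> H) = (\<one> H \<otimes> (s \<star>\<^sub>1 \<one> H)) \<cdot> (d \<otimes> \<one> H)"
proof -
  have "(\<one> H \<otimes> (\<one> H \<otimes> s)) \<cdot> (d \<otimes> \<one> H) = (\<one> (H \<odot> H) \<otimes> s) \<cdot> (d \<otimes> \<one> H)"
    by (simp add: tensor_arr_assoc flip: tensor_ident)
  also have "\<dots> = d \<otimes> s" by (simp add: interchange_Arr)
  finally show "(\<one> H \<otimes> \<mu>) \<cdot> (d \<otimes> s) = (\<one> H \<otimes> (\<one> H \<star>\<^sub>1 s)) \<cdot> (d \<otimes> \<one> H)"
    by (simp add: conv_def whisker_cmp cmp_assoc_Arr)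
  show "(\<one> H \<otimes> \<mu>) \<cdot> (((\<one> H \<otimes> s) \<cdot> d) \<otimes> \<one> H) = (\<one> H \<otimes> (s \<star>\<^sub>1 \<one> H)) \<cdot> (d \<otimes> \<one> H)"
    by (simp add: conv_def whisker_cmp cmp_assoc_Arr tensor_arr_assoc)
qed

lemma antipode_mult_S_right: "(\<one> H \<otimes> mult_S_right) \<cdot> (\<delta> \<otimes> \<one> H) \<cdot> \<delta> = \<one> H \<otimes> \<eta>"
  and antipode_mult_S_left: "(\<one> H \<otimes> mult_S_left) \<cdot> (\<delta> \<otimes> \<one> H) \<cdot> \<delta> = \<one> H \<otimes> \<eta>"
  using antipode whiskered_mult[of \<delta> S]
  by (simp_all add: is_antipode_def mult_S_right_def mult_S_left_def conv_def flip: cmp_assoc_Arr)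

lemma antipode_conv_right: "(\<delta> \<star>\<^sub>2 (\<eta> \<otimes> S)) \<cdot> \<delta> = \<one> H \<otimes> \<eta>"
proof -
  have "\<delta> \<star>\<^sub>2 (\<eta> \<otimes> S) = ((\<one> H \<otimes> \<one> H) \<star>\<^sub>2 (\<eta> \<otimes> S)) \<cdot> (\<delta> \<otimes> \<one> H)"
    using conv_cmp_left[of \<mu>2 "\<one> H \<otimes> \<one> H" "\<eta> \<otimes> S" \<delta>] by (simp add: tensor_ident)
  also have "\<dots> = (\<one> H \<otimes> mult_S_right) \<cdot> (\<delta> \<otimes> \<one> H)"
    by (subst conv2_tensor) (simp_all add: conv_def[of C \<mu> "\<one> H" S] mult_S_right_def)
  finally show ?thesis using antipode_mult_S_right by (simp add: cmp_assoc_Arr)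
qed

text \<open>Apply \<open>\<epsilon>\<close> to the first tensor factor of \<open>h11 \<otimes> h12 S(h2) = h \<otimes> 1\<close>.\<close>

lemma mult_S_right_comult: "mult_S_right \<cdot> \<delta> = \<eta> \<cdot> \<epsilon>"
proof -
  have a: "(\<one> H \<otimes> \<mu>) \<cdot> (\<delta> \<otimes> S) \<cdot> \<delta> = \<one> H \<otimes> \<eta>"
    using antipode by (simp add: is_antipode_def)
  have "\<eta> \<cdot> \<epsilon> = (\<epsilon> \<otimes> \<one> H) \<cdot> (\<one> H \<otimes> \<eta>)"
    using interchange_Arr[of "\<one> H" \<epsilon> \<eta> "\<one> H"] interchange_Arr[of \<epsilon> "\<one> \<bbbK>" "\<one> \<bbbK>" \<eta>] by simp
  also have "\<dots> = ((\<epsilon> \<otimes> \<one> H) \<cdot> (\<one> H \<otimes> \<mu>)) \<cdot> (\<delta> \<otimes> S) \<cdot> \<delta>"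
    by (simp add: cmp_assoc_Arr flip: a)
  also have "(\<epsilon> \<otimes> \<one> H) \<cdot> (\<one> H \<otimes> \<mu>) = \<mu> \<cdot> ((\<epsilon> \<otimes> \<one> H) \<otimes> \<one> H)"
    using interchange_Arr[of "\<one> H" \<epsilon> \<mu> "\<one> H"] interchange_Arr[of \<epsilon> "\<one> \<bbbK>" "\<one> (H \<odot> H)" \<mu>]
    by (simp add: tensor_arr_assoc tensor_ident)
  also have "(\<mu> \<cdot> ((\<epsilon> \<otimes> \<one> H) \<otimes> \<one> H)) \<cdot> (\<delta> \<otimes> S) \<cdot> \<delta> = \<mu> \<cdot> (((\<epsilon> \<otimes> \<one> H) \<otimes> \<one> H) \<cdot> (\<delta> \<otimes> S)) \<cdot> \<delta>"
    by (simp add: cmp_assoc_Arr)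
  also have "\<dots> = mult_S_right \<cdot> \<delta>"
    by (simp add: interchange_Arr mult_S_right_def cmp_assoc_Arr)
  finally show ?thesis by simp
qed

text \<open>Apply \<open>\<epsilon>\<close> to the last tensor factor of \<open>S(h1) h21 \<otimes> h22 = 1 \<otimes> h\<close>.\<close>

lemma mult_S_left_comult: "mult_S_left \<cdot> \<delta> = \<eta> \<cdot> \<epsilon>"
proof -
  have a: "(\<mu> \<otimes> \<one> H) \<cdot> (S \<otimes> \<delta>) \<cdot> \<delta> = \<eta> \<otimes> \<one> H"
    using antipode by (simp add: is_antipode_def)
  have "\<eta> \<cdot> \<epsilon> = (\<one> H \<otimes> \<epsilon>) \<cdot> (\<eta> \<otimes> \<one> H)"
    using interchange_Arr[of \<eta> "\<one> H" "\<one> H" \<epsilon>] interchange_Arr[of "\<one> \<bbbK>" \<eta> \<epsilon> "\<one> \<bbbK>"] by simp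
  also have "\<dots> = ((\<one> H \<otimes> \<epsilon>) \<cdot> (\<mu> \<otimes> \<one> H)) \<cdot> (S \<otimes> \<delta>) \<cdot> \<delta>"
    by (simp add: cmp_assoc_Arr flip: a)
  also have "(\<one> H \<otimes> \<epsilon>) \<cdot> (\<mu> \<otimes> \<one> H) = \<mu> \<cdot> (\<one> H \<otimes> (\<one> H \<otimes> \<epsilon>))"
    using interchange_Arr[of \<mu> "\<one> H" "\<one> H" \<epsilon>] interchange_Arr[of "\<one> (H \<odot> H)" \<mu> \<epsilon> "\<one> \<bbbK>"]
    by (simp flip: tensor_arr_assoc add: tensor_ident)
  also have "(\<mu> \<cdot> (\<one> H \<otimes> (\<one> H \<otimes> \<epsilon>))) \<cdot> (S \<otimes> \<delta>) \<cdot> \<delta> = \<mu> \<cdot> ((\<one> H \<otimes> (\<one> H \<otimes> \<epsilon>)) \<cdot> (S \<otimes> \<delta>)) \<cdot> \<delta>"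
    by (simp add: cmp_assoc_Arr)
  also have "\<dots> = mult_S_left \<cdot> \<delta>"
    by (simp add: interchange_Arr mult_S_left_def cmp_assoc_Arr)
  finally show ?thesis by simp
qed

lemma S_unit [simp]: "S \<cdot> \<eta> = \<eta>"
proof -
  have "\<eta> = (mult_S_left \<cdot> \<delta>) \<cdot> \<eta>" by (simp add: mult_S_left_comult cmp_assoc_Arr)
  also have "\<dots> = mult_S_left \<cdot> (\<eta> \<otimes> \<eta>)" by (simp add: cmp_assoc_Arr)
  also have "\<dots> = (S \<cdot> \<eta>) \<star>\<^sub>1 \<eta>" by (simp add: mult_S_left_def conv_def cmp_assoc_Arr interchange_Arr del: conv_units)
  finally show ?thesis by simp
qed

lemma mult_S_left_conv2:
  assumes [simp]: "x \<in> Arr C" "Cod C x = H \<odot> H" "k \<in> Arr C" "Cod C k = H"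
  shows "mult_S_left \<cdot> (x \<star>\<^sub>2 (\<eta> \<otimes> k)) = (mult_S_left \<cdot> x) \<star>\<^sub>1 k"
proof -
  have "x \<star>\<^sub>2 (\<eta> \<otimes> k) = ((\<one> H \<otimes> \<one> H) \<star>\<^sub>2 (\<eta> \<otimes> k)) \<cdot> (x \<otimes> \<one> (Dom C k))"
    using conv_cmp_left[of \<mu>2 "\<one> H \<otimes> \<one> H" "\<eta> \<otimes> k" x] by (simp add: tensor_ident)
  also have "(\<one> H \<otimes> \<one> H) \<star>\<^sub>2 (\<eta> \<otimes> k) = \<one> H \<otimes> (\<one> H \<star>\<^sub>1 k)"
    by (subst conv2_tensor) simp_all
  finally have "mult_S_left \<cdot> (x \<star>\<^sub>2 (\<eta> \<otimes> k)) = \<mu> \<cdot> ((S \<otimes> \<one> H) \<cdot> (\<one> H \<otimes> (\<one> H \<star>\<^sub>1 k))) \<cdot> (x \<otimes> \<one> (Dom C k))"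
    by (simp add: mult_S_left_def cmp_assoc_Arr)
  also have "\<dots> = (S \<star>\<^sub>1 (\<one> H \<star>\<^sub>1 k)) \<cdot> (x \<otimes> \<one> (Dom C k))"
    by (simp add: interchange_Arr conv_def[of C \<mu> S] cmp_assoc_Arr)
  also have "\<dots> = ((S \<star>\<^sub>1 \<one> H) \<star>\<^sub>1 k) \<cdot> (x \<otimes> \<one> (Dom C k))"
    by (simp add: conv_assocs)
  also have "\<dots> = (mult_S_left \<cdot> x) \<star>\<^sub>1 k"
    by (subst conv_cmp_left[symmetric]) (simp_all add: mult_S_left_def conv_def)
  finally show ?thesis .
qed

text \<open>Evaluate \<open>S(h11 k11) h12 k12 S(k2) S(h2)\<close> in two ways. Applying \<open>k11 \<otimes> k12 S(k2) = k \<otimes> 1\<close> and then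
the same for \<open>h\<close> leaves \<open>S(h k)\<close>. Since \<open>\<delta>\<close> is multiplicative, the first factors combine to
\<open>S((h1 k1)1) (h1 k1)2 = \<epsilon>(h1 k1)\<close>, which leaves \<open>S(k) S(h)\<close>.\<close>

lemma antipode_antimultiplicative: "S \<cdot> \<mu> = \<mu> \<cdot> (S \<otimes> S) \<cdot> \<sigma> H H"
proof -
  \<comment> \<open>\<open>F\<close> is the product \<open>\<delta>(a) \<delta>(b) (1 \<otimes> S(c)) (1 \<otimes> S(d))\<close> in \<open>H \<otimes> H\<close>, and \<open>?P\<close> substitutes
    \<open>a = h1, b = k1, c = k2, d = h2\<close>.\<close>
  define F where "F = \<delta> \<star>\<^sub>2 (\<delta> \<star>\<^sub>2 (\<eta> \<otimes> S) \<star>\<^sub>2 (\<eta> \<otimes> S))"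
  let ?P = "(\<one> H \<otimes> \<delta> \<otimes> \<one> H) \<cdot> (\<one> H \<otimes> \<sigma> H H) \<cdot> (\<delta> \<otimes> \<one> H)"
  have F_simps [simp]: "F \<in> Arr C" "Dom C F = H \<odot> (H \<odot> (H \<odot> H))" "Cod C F = H \<odot> H"
    by (simp_all add: F_def)
  have comm: "(\<one> H \<otimes> \<eta>) \<star>\<^sub>2 (\<eta> \<otimes> S) = ((\<eta> \<otimes> S) \<star>\<^sub>2 (\<one> H \<otimes> \<eta>)) \<cdot> \<sigma> H H"
  proof -
    have "(\<one> H \<otimes> \<eta>) \<star>\<^sub>2 (\<eta> \<otimes> S) = \<one> H \<otimes> S"
      by (subst conv2_tensor) simp_all
    moreover have "(\<eta> \<otimes> S) \<star>\<^sub>2 (\<one> H \<otimes> \<eta>) = (\<one> H \<otimes> S) \<cdot> \<sigma> H H"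
      unfolding \<mu>2_def
      by (subst tensor_pairing_tensor[OF H_hom(2) H_hom(2) H_hom(1,5) ident_closed H_hom(1)])
        (simp_all)
    ultimately show ?thesis by (simp add: cmp_assoc_Arr symm_involutive tensor_ident)
  qed
  have e1: "F \<cdot> (\<one> H \<otimes> \<delta> \<otimes> \<one> H) =
      (\<delta> \<star>\<^sub>2 ((\<eta> \<otimes> S) \<star>\<^sub>2 (\<one> H \<otimes> \<eta>))) \<cdot> (\<one> H \<otimes> \<sigma> H H)"
  proof -
    have "F \<cdot> (\<one> H \<otimes> \<delta> \<otimes> \<one> H) = \<delta> \<star>\<^sub>2 (((\<delta> \<star>\<^sub>2 (\<eta> \<otimes> S)) \<cdot> \<delta>) \<star>\<^sub>2 (\<eta> \<otimes> S))"
      by (simp add: F_def conv_cmp_left conv_cmp_right tensor_arr_assoc)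
    also have "\<dots> = \<delta> \<star>\<^sub>2 (((\<eta> \<otimes> S) \<star>\<^sub>2 (\<one> H \<otimes> \<eta>)) \<cdot> \<sigma> H H)"
      by (simp add: antipode_conv_right comm)
    also have "\<dots> = (\<delta> \<star>\<^sub>2 ((\<eta> \<otimes> S) \<star>\<^sub>2 (\<one> H \<otimes> \<eta>))) \<cdot> (\<one> H \<otimes> \<sigma> H H)"
      by (simp add: conv_cmp_right)
    finally show ?thesis .
  qed
  have "F \<cdot> ?P = (\<delta> \<star>\<^sub>2 ((\<eta> \<otimes> S) \<star>\<^sub>2 (\<one> H \<otimes> \<eta>))) \<cdot> ((\<one> H \<otimes> \<sigma> H H) \<cdot> (\<one> H \<otimes> \<sigma> H H)) \<cdot> (\<delta> \<otimes> \<one> H)"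
    by (simp add: cmp_reassoc[OF e1]) (simp add: cmp_assoc_Arr)
  also have "\<dots> = ((\<delta> \<star>\<^sub>2 (\<eta> \<otimes> S)) \<star>\<^sub>2 (\<one> H \<otimes> \<eta>)) \<cdot> (\<delta> \<otimes> \<one> H)"
    by (simp add: interchange_Arr symm_involutive tensor_ident conv_assocs)
  also have "\<dots> = (\<one> H \<otimes> \<eta>) \<star>\<^sub>2 (\<one> H \<otimes> \<eta>)"
    using conv_cmp_left[of \<mu>2 "\<delta> \<star>\<^sub>2 (\<eta> \<otimes> S)" "\<one> H \<otimes> \<eta>" \<delta>] by (simp add: antipode_conv_right)
  also have "\<dots> = \<mu> \<otimes> \<eta>"
    by (subst conv2_tensor) (simp_all add: conv_def[of C \<mu> "\<one> H"] tensor_ident)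
  finally have 1: "mult_S_left \<cdot> F \<cdot> ?P = mult_S_left \<cdot> (\<mu> \<otimes> \<eta>)" by simp
  have eF: "F = (\<delta> \<cdot> \<mu>) \<star>\<^sub>2 (\<eta> \<otimes> S) \<star>\<^sub>2 (\<eta> \<otimes> S)"
    by (simp add: F_def conv_assocs comult_mult conv_def[of C \<mu>2 \<delta> \<delta>, symmetric])
  have e2: "mult_S_left \<cdot> F = \<mu> \<cdot> (S \<otimes> S) \<cdot> ((\<epsilon> \<otimes> \<epsilon>) \<otimes> \<one> (H \<odot> H))"
  proof -
    have "mult_S_left \<cdot> F = ((mult_S_left \<cdot> \<delta>) \<cdot> \<mu>) \<star>\<^sub>1 S \<star>\<^sub>1 S"
      unfolding eF by (simp add: mult_S_left_conv2 cmp_assoc_Arr)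
    also have "\<dots> = (\<eta> \<cdot> (\<epsilon> \<otimes> \<epsilon>)) \<star>\<^sub>1 (S \<star>\<^sub>1 S)"
      by (simp add: mult_S_left_comult cmp_assoc_Arr conv_assocs)
    also have "\<dots> = \<mu> \<cdot> (S \<otimes> S) \<cdot> ((\<epsilon> \<otimes> \<epsilon>) \<otimes> \<one> (H \<odot> H))"
      by (simp add: conv_cmp_left) (simp add: conv_def cmp_assoc_Arr)
    finally show ?thesis .
  qed
  have "mult_S_left \<cdot> F \<cdot> ?P = \<mu> \<cdot> (S \<otimes> S) \<cdot> ((\<epsilon> \<otimes> \<epsilon>) \<otimes> \<one> (H \<odot> H)) \<cdot> ?P"
    by (simp add: cmp_reassoc[OF e2]) (simp add: cmp_assoc_Arr)
  also have "((\<epsilon> \<otimes> \<epsilon>) \<otimes> \<one> (H \<odot> H)) \<cdot> ?P = \<sigma> H H"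
  proof -
    have e3: "((\<epsilon> \<otimes> \<epsilon>) \<otimes> \<one> (H \<odot> H)) \<cdot> (\<one> H \<otimes> \<delta> \<otimes> \<one> H) = \<epsilon> \<otimes> \<one> (H \<odot> H)"
    proof -
      have "((\<epsilon> \<otimes> \<epsilon>) \<otimes> \<one> (H \<odot> H)) \<cdot> (\<one> H \<otimes> \<delta> \<otimes> \<one> H) = (\<epsilon> \<otimes> ((\<epsilon> \<otimes> \<one> H) \<otimes> \<one> H)) \<cdot> (\<one> H \<otimes> (\<delta> \<otimes> \<one> H))"
        by (simp add: tensor_arr_assoc flip: tensor_ident)
      also have "\<dots> = \<epsilon> \<otimes> \<one> (H \<odot> H)" by (simp add: interchange_Arr tensor_ident)
      finally show ?thesis .
    qed
    have "((\<epsilon> \<otimes> \<epsilon>) \<otimes> \<one> (H \<odot> H)) \<cdot> ?P = ((\<epsilon> \<otimes> \<one> (H \<odot> H)) \<cdot> (\<one> H \<otimes> \<sigma> H H)) \<cdot> (\<delta> \<otimes> \<one> H)"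
      by (simp add: cmp_reassoc[OF e3]) (simp add: cmp_assoc_Arr)
    also have "(\<epsilon> \<otimes> \<one> (H \<odot> H)) \<cdot> (\<one> H \<otimes> \<sigma> H H) = \<sigma> H H \<cdot> ((\<epsilon> \<otimes> \<one> H) \<otimes> \<one> H)"
      using interchange_Arr[of \<epsilon> "\<one> \<bbbK>" "\<one> (H \<odot> H)" "\<sigma> H H"]
      by (simp add: interchange_Arr tensor_arr_assoc tensor_ident)
    finally show ?thesis by (simp add: cmp_assoc_Arr interchange_Arr tensor_ident)
  qed
  finally have "mult_S_left \<cdot> (\<mu> \<otimes> \<eta>) = \<mu> \<cdot> (S \<otimes> S) \<cdot> \<sigma> H H" using 1 by simp
  moreover have "mult_S_left \<cdot> (\<mu> \<otimes> \<eta>) = (S \<cdot> \<mu>) \<star>\<^sub>1 \<eta>"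
    by (simp add: mult_S_left_def conv_def cmp_assoc_Arr interchange_Arr del: conv_units)
  ultimately show ?thesis by simp
qed

end

section \<open>Reversing the tensor product\<close>

text \<open>The monoidal category with \<open>A \<odot> B\<close> replaced by \<open>B \<odot> A\<close>. A Hopf coquasigroup \<open>H\<close> becomes the one with
opposite product and opposite coproduct, given by the same arrows; this exchanges the two pairs of
antipode equations and left with right actions.\<close>

definition mirror :: "('o, 'a, 'm) sm_struct_scheme \<Rightarrow> ('o, 'a, 'm) sm_struct_scheme" where
  "mirror C = C\<lparr>tensor_obj := \<lambda>A B. tensor_obj C B A, tensor_arr := \<lambda>f g. tensor_arr C g f,
    symm := \<lambda>A B. symm C B A\<rparr>"

lemma mirror_simps [simp]:
  "Obj (mirror C) = Obj C" "Arr (mirror C) = Arr C" "Dom (mirror C) = Dom C" "Cod (mirror C) = Cod C"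
  "ident (mirror C) = ident C" "cmp (mirror C) = cmp C" "unit_obj (mirror C) = unit_obj C"
  "tensor_obj (mirror C) A B = tensor_obj C B A" "tensor_arr (mirror C) f g = tensor_arr C g f"
  "symm (mirror C) A B = symm C B A" "hom (mirror C) A B = hom C A B" "conv (mirror C) p f g = conv C p g f"
  by (simp_all add: mirror_def hom_def conv_def)

context strict_symmetric_monoidal_category
begin

lemma mirror_symmetric_monoidal: "strict_symmetric_monoidal_category (mirror C)"
  by unfold_locales
    (auto simp: hom_iff cmp_assoc_Arr interchange_Arr tensor_arr_assoc tensor_ident symm_natural_Arr
      symm_involutive symm_hexagon_left)

lemma mirror_tensor_pairing:
  assumes "A \<in> Obj C" "B \<in> Obj C" "A' \<in> Obj C" "B' \<in> Obj C"
  shows "tensor_pairing (mirror C) A A' B B' p p' = tensor_pairing C B' B A' A p' p"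
  using assms by (simp add: tensor_pairing_def tensor_arr_assoc)

end

context hopf_coquasigroup
begin

lemma mirror_hopf_coquasigroup: "hopf_coquasigroup (mirror C) H \<eta> \<mu> \<epsilon> \<delta> S"
proof -
  interpret r: strict_symmetric_monoidal_category "mirror C" by (rule mirror_symmetric_monoidal)
  have "tensor_mult (mirror C) H \<mu> H \<mu> = tensor_mult C H \<mu> H \<mu>"
    by (simp add: tensor_mult_def tensor_arr_assoc)
  then show ?thesis
    using bimonoid antipode
    by unfold_locales
      (auto simp: is_noncoassociative_bimonoid_def is_monoid_def is_counital_comagma_def is_antipode_def)
qed

section \<open>Actions built from the antipode\<close>

text \<open>In elements \<open>adj_left\<close> is \<open>a \<otimes> b \<otimes> z \<mapsto> a z S(b)\<close> and \<open>adj_right\<close> is \<open>z \<otimes> a \<otimes> b \<mapsto> S(a) z b\<close>. They are mirror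
images of each other.\<close>

definition "adj_left = \<mu> \<cdot> (\<one> H \<otimes> (\<mu> \<cdot> (\<one> H \<otimes> S) \<cdot> \<sigma> H H))"
definition "adj_right = \<mu> \<cdot> ((\<mu> \<cdot> (S \<otimes> \<one> H) \<cdot> \<sigma> H H) \<otimes> \<one> H)"

lemma adj_left_simps [simp]: "adj_left \<in> Arr C" "Dom C adj_left = H \<odot> (H \<odot> H)" "Cod C adj_left = H"
  and adj_right_simps [simp]: "adj_right \<in> Arr C" "Dom C adj_right = H \<odot> (H \<odot> H)" "Cod C adj_right = H"
  by (simp_all add: adj_left_def adj_right_def)

lemma mult_assoc: "\<mu> \<cdot> (\<mu> \<otimes> \<one> H) = \<mu> \<cdot> (\<one> H \<otimes> \<mu>)"
  using monoid1 by (simp add: is_monoid_def)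

text \<open>\<open>H\<close> acts on itself by left multiplication and by \<open>b \<otimes> z \<mapsto> z S(b)\<close>, which is a left action since
\<open>S\<close> is antimultiplicative. The two actions commute, so together they are an action of \<open>H \<otimes> H\<close>.\<close>

lemma adj_left_assoc: "adj_left \<cdot> (\<mu>2 \<otimes> \<one> H) = adj_left \<cdot> (\<one> (H \<odot> H) \<otimes> adj_left)"
proof -
  define b where "b = \<mu> \<cdot> (\<one> H \<otimes> S) \<cdot> \<sigma> H H"
  have b [simp]: "b \<in> Arr C" "Dom C b = H \<odot> H" "Cod C b = H" by (simp_all add: b_def)
  have adj_left: "adj_left = \<mu> \<cdot> (\<one> H \<otimes> b)" by (simp add: adj_left_def b_def)
  \<comment> \<open>\<open>(b d) z = z S(b d) = (z S(d)) S(b)\<close>\<close>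
  have b1: "b \<cdot> (\<mu> \<otimes> \<one> H) = b \<cdot> (\<one> H \<otimes> b)"
  proof -
    \<comment> \<open>the Yang--Baxter equation, with two of its sides contracted by the hexagons\<close>
    have yb: "(\<one> H \<otimes> \<sigma> H H) \<cdot> \<sigma> (H \<odot> H) H = (\<sigma> H H \<otimes> \<one> H) \<cdot> \<sigma> H (H \<odot> H)"
    proof -
      have "(\<one> H \<otimes> \<sigma> H H) \<cdot> \<sigma> (H \<odot> H) H = \<sigma> H (H \<odot> H) \<cdot> (\<one> H \<otimes> \<sigma> H H)"
        by (simp add: symm_hexagon symm_hexagon_left cmp_assoc_Arr)
      also have "\<dots> = (\<sigma> H H \<otimes> \<one> H) \<cdot> \<sigma> H (H \<odot> H)"
        by (simp add: symm_natural_Arr)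
      finally show ?thesis .
    qed
    have "b \<cdot> (\<mu> \<otimes> \<one> H) = \<mu> \<cdot> ((\<one> H \<otimes> S) \<cdot> (\<one> H \<otimes> \<mu>)) \<cdot> \<sigma> (H \<odot> H) H"
      by (simp add: b_def cmp_assoc_Arr symm_natural_Arr)
    also have "(\<one> H \<otimes> S) \<cdot> (\<one> H \<otimes> \<mu>) = (\<one> H \<otimes> \<mu>) \<cdot> (\<one> H \<otimes> (S \<otimes> S)) \<cdot> (\<one> H \<otimes> \<sigma> H H)"
      by (simp add: interchange_Arr antipode_antimultiplicative)
    also have "\<mu> \<cdot> \<dots> \<cdot> \<sigma> (H \<odot> H) H
        = \<mu> \<cdot> (\<one> H \<otimes> \<mu>) \<cdot> (\<one> H \<otimes> (S \<otimes> S)) \<cdot> (\<sigma> H H \<otimes> \<one> H) \<cdot> \<sigma> H (H \<odot> H)"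
      by (simp add: cmp_assoc_Arr yb)
    also have "\<dots> = \<mu> \<cdot> (\<mu> \<otimes> \<one> H) \<cdot> (\<one> H \<otimes> (S \<otimes> S)) \<cdot> (\<sigma> H H \<otimes> \<one> H) \<cdot> \<sigma> H (H \<odot> H)"
      by (simp add: cmp_reassoc[OF mult_assoc] cmp_assoc_Arr)
    also have "(\<mu> \<otimes> \<one> H) \<cdot> (\<one> H \<otimes> (S \<otimes> S)) \<cdot> (\<sigma> H H \<otimes> \<one> H) \<cdot> \<sigma> H (H \<odot> H)
       = ((\<mu> \<otimes> \<one> H) \<cdot> ((\<one> H \<otimes> S) \<otimes> S) \<cdot> (\<sigma> H H \<otimes> \<one> H)) \<cdot> \<sigma> H (H \<odot> H)"
      by (simp add: cmp_assoc_Arr tensor_arr_assoc)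
    also have "(\<mu> \<otimes> \<one> H) \<cdot> ((\<one> H \<otimes> S) \<otimes> S) \<cdot> (\<sigma> H H \<otimes> \<one> H) = (\<one> H \<otimes> S) \<cdot> (b \<otimes> \<one> H)"
      by (simp add: b_def interchange_Arr)
    also have "\<mu> \<cdot> ((\<one> H \<otimes> S) \<cdot> (b \<otimes> \<one> H)) \<cdot> \<sigma> H (H \<odot> H) = (\<mu> \<cdot> (\<one> H \<otimes> S)) \<cdot> \<sigma> H H \<cdot> (\<one> H \<otimes> b)"
      by (simp add: symm_natural_Arr cmp_assoc_Arr)
    also have "\<dots> = b \<cdot> (\<one> H \<otimes> b)"
      by (subst (2) b_def) (simp add: cmp_assoc_Arr)
    finally show ?thesis .
  qed
  \<comment> \<open>\<open>(a z) S(b) = a (z S(b))\<close>\<close>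
  have b2: "b \<cdot> (\<one> H \<otimes> \<mu>) = \<mu> \<cdot> (\<one> H \<otimes> b) \<cdot> (\<sigma> H H \<otimes> \<one> H)"
  proof -
    have "b \<cdot> (\<one> H \<otimes> \<mu>) = \<mu> \<cdot> ((\<one> H \<otimes> S) \<cdot> (\<mu> \<otimes> \<one> H)) \<cdot> \<sigma> H (H \<odot> H)"
      by (simp add: b_def cmp_assoc_Arr symm_natural_Arr)
    also have "(\<one> H \<otimes> S) \<cdot> (\<mu> \<otimes> \<one> H) = (\<mu> \<otimes> \<one> H) \<cdot> (\<one> H \<otimes> (\<one> H \<otimes> S))"
      using interchange_Arr[of "\<one> (H \<odot> H)" \<mu> S "\<one> H"]
      by (simp add: interchange_Arr tensor_ident flip: tensor_arr_assoc)
    also have "\<mu> \<cdot> \<dots> \<cdot> \<sigma> H (H \<odot> H) = \<mu> \<cdot> (\<one> H \<otimes> b) \<cdot> (\<sigma> H H \<otimes> \<one> H)"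
      by (simp add: cmp_assoc_Arr cmp_reassoc[OF mult_assoc] symm_hexagon b_def whisker_cmp)
    finally show ?thesis .
  qed
  have "adj_left \<cdot> (\<mu>2 \<otimes> \<one> H) = \<mu> \<cdot> ((\<one> H \<otimes> b) \<cdot> ((\<mu> \<otimes> \<mu>) \<otimes> \<one> H)) \<cdot> (\<one> H \<otimes> \<sigma> H H \<otimes> \<one> (H \<odot> H))"
    by (simp add: adj_left \<mu>2_def tensor_pairing_def whisker_cmp cmp_assoc_Arr tensor_arr_assoc tensor_ident)
  also have "(\<one> H \<otimes> b) \<cdot> ((\<mu> \<otimes> \<mu>) \<otimes> \<one> H) = (\<mu> \<otimes> \<one> H) \<cdot> (\<one> (H \<odot> H) \<otimes> b) \<cdot> (\<one> (H \<odot> H) \<otimes> (\<one> H \<otimes> b))"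
    by (simp add: tensor_arr_assoc interchange_Arr b1)
  also have "\<mu> \<cdot> \<dots> \<cdot> (\<one> H \<otimes> \<sigma> H H \<otimes> \<one> (H \<odot> H))
     = \<mu> \<cdot> (\<one> H \<otimes> \<mu>) \<cdot> (\<one> (H \<odot> H) \<otimes> b) \<cdot> ((\<one> (H \<odot> H \<odot> H) \<otimes> b) \<cdot> ((\<one> H \<otimes> \<sigma> H H) \<otimes> \<one> (H \<odot> H)))"
    by (simp add: cmp_assoc_Arr cmp_reassoc[OF mult_assoc] tensor_arr_assoc flip: tensor_ident)
  also have "(\<one> (H \<odot> H \<odot> H) \<otimes> b) \<cdot> ((\<one> H \<otimes> \<sigma> H H) \<otimes> \<one> (H \<odot> H)) = (\<one> H \<otimes> \<sigma> H H \<otimes> \<one> H) \<cdot> (\<one> (H \<odot> H \<odot> H) \<otimes> b)"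
    by (simp add: interchange_Arr)
  also have "\<mu> \<cdot> (\<one> H \<otimes> \<mu>) \<cdot> (\<one> (H \<odot> H) \<otimes> b) \<cdot> \<dots>
     = \<mu> \<cdot> (\<one> H \<otimes> (\<mu> \<cdot> (\<one> H \<otimes> b) \<cdot> (\<sigma> H H \<otimes> \<one> H))) \<cdot> (\<one> (H \<odot> H \<odot> H) \<otimes> b)"
    by (simp add: cmp_assoc_Arr whisker_cmp tensor_arr_assoc flip: tensor_ident)
  also have "\<dots> = \<mu> \<cdot> (\<one> H \<otimes> (b \<cdot> (\<one> H \<otimes> \<mu>))) \<cdot> (\<one> (H \<odot> H \<odot> H) \<otimes> b)"
    unfolding b2 by simp
  also have "\<dots> = adj_left \<cdot> (\<one> (H \<odot> H) \<otimes> adj_left)"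
    by (simp add: adj_left cmp_assoc_Arr whisker_cmp tensor_arr_assoc flip: tensor_ident)
  finally show ?thesis .
qed

lemma mirror_\<mu>2: "hopf_coquasigroup.\<mu>2 (mirror C) H \<mu> = \<mu>2"
  using hopf_coquasigroup.\<mu>2_def[OF mirror_hopf_coquasigroup] by (simp add: \<mu>2_def mirror_tensor_pairing)

lemma mirror_\<mu>3: "hopf_coquasigroup.\<mu>3 (mirror C) H \<mu> = \<mu>3"
  using hopf_coquasigroup.\<mu>3_def[OF mirror_hopf_coquasigroup]
  by (simp add: \<mu>3_coherence mirror_tensor_pairing mirror_\<mu>2)

lemma mirror_mult_S_right: "hopf_coquasigroup.mult_S_right (mirror C) H \<mu> S = mult_S_left"
  and mirror_mult_S_left: "hopf_coquasigroup.mult_S_left (mirror C) H \<mu> S = mult_S_right"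
  and mirror_adj_left: "hopf_coquasigroup.adj_left (mirror C) H \<mu> S = adj_right"
  using hopf_coquasigroup.mult_S_right_def[OF mirror_hopf_coquasigroup]
    hopf_coquasigroup.mult_S_left_def[OF mirror_hopf_coquasigroup]
    hopf_coquasigroup.adj_left_def[OF mirror_hopf_coquasigroup]
  by (simp_all add: mult_S_right_def mult_S_left_def adj_right_def)

lemma adj_right_assoc: "adj_right \<cdot> (adj_right \<otimes> \<one> (H \<odot> H)) = adj_right \<cdot> (\<one> H \<otimes> \<mu>2)"
  using hopf_coquasigroup.adj_left_assoc[OF mirror_hopf_coquasigroup] by (simp add: mirror_adj_left mirror_\<mu>2)

lemma adj_left_hom: "adj_left \<in> hom C (H \<odot> H \<odot> H) H" and adj_right_hom: "adj_right \<in> hom C (H \<odot> (H \<odot> H)) H"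
  by (simp_all add: hom_iff)

lemma adj_left_conv_assoc:
  "\<lbrakk>x \<in> Arr C; Cod C x = H \<odot> H; y \<in> Arr C; Cod C y = H \<odot> H; z \<in> Arr C; Cod C z = H\<rbrakk>
    \<Longrightarrow> conv C adj_left (x \<star>\<^sub>2 y) z = conv C adj_left x (conv C adj_left y z)"
  by (rule conv_assoc[OF adj_left_assoc \<mu>2_hom adj_left_hom adj_left_hom adj_left_hom]) simp_all

lemma adj_right_conv_assoc:
  "\<lbrakk>x \<in> Arr C; Cod C x = H \<odot> H; y \<in> Arr C; Cod C y = H \<odot> H; z \<in> Arr C; Cod C z = H\<rbrakk>
    \<Longrightarrow> conv C adj_right (conv C adj_right z x) y = conv C adj_right z (x \<star>\<^sub>2 y)"
  by (rule conv_assoc[OF adj_right_assoc adj_right_hom \<mu>2_hom adj_right_hom adj_right_hom]) simp_all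

lemma adj_left_conv_id:
  assumes [simp]: "k \<in> Arr C" "Dom C k = \<bbbK>" "Cod C k = H"
  shows "conv C adj_left (\<one> (H \<odot> H)) k = \<one> H \<star>\<^sub>1 (k \<star>\<^sub>1 S)"
proof -
  have "conv C adj_left (\<one> (H \<odot> H)) k = \<mu> \<cdot> (\<one> H \<otimes> (\<mu> \<cdot> (\<one> H \<otimes> S) \<cdot> (\<sigma> H H \<cdot> (\<one> H \<otimes> k))))"
    by (simp add: conv_def adj_left_def whisker_cmp cmp_assoc_Arr tensor_arr_assoc flip: tensor_ident)
  also have "\<sigma> H H \<cdot> (\<one> H \<otimes> k) = k \<otimes> \<one> H"
    by (simp add: symm_natural_Arr)
  also have "\<mu> \<cdot> (\<one> H \<otimes> (\<mu> \<cdot> (\<one> H \<otimes> S) \<cdot> (k \<otimes> \<one> H))) = \<one> H \<star>\<^sub>1 (k \<star>\<^sub>1 S)"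
    by (simp add: conv_def interchange_Arr)
  finally show ?thesis .
qed

lemma adj_right_conv_id:
  assumes [simp]: "k \<in> Arr C" "Dom C k = \<bbbK>" "Cod C k = H"
  shows "conv C adj_right k (\<one> (H \<odot> H)) = (S \<star>\<^sub>1 k) \<star>\<^sub>1 \<one> H"
  using hopf_coquasigroup.adj_left_conv_id[OF mirror_hopf_coquasigroup, of k] by (simp add: mirror_adj_left)

lemma adj_left_conv_unit: 
  assumes [simp]: "x \<in> Arr C" "Cod C x = H \<odot> H"
  shows "conv C adj_left x \<eta> = mult_S_right \<cdot> x"
  using conv_cmp_left[of adj_left "\<one> (H \<odot> H)" \<eta> x] adj_left_conv_id[of \<eta>] by (simp add: mult_S_right_def conv_def[of C \<mu> "\<one> H" S])

lemma adj_right_conv_unit: 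
  assumes [simp]: "x \<in> Arr C" "Cod C x = H \<odot> H"
  shows "conv C adj_right \<eta> x = mult_S_left \<cdot> x"
  using conv_cmp_right[of adj_right \<eta> "\<one> (H \<odot> H)" x] adj_right_conv_id[of \<eta>] by (simp add: mult_S_left_def conv_def[of C \<mu> S "\<one> H"])

text \<open>The actions of \<open>H \<otimes> (H \<otimes> H)\<close> on \<open>H \<otimes> H\<close>:
\<open>(a \<otimes> b \<otimes> c) (p \<otimes> q) = a p \<otimes> b q S(c)\<close> and \<open>(p \<otimes> q) (a \<otimes> b \<otimes> c) = p a \<otimes> S(b) q c\<close>.\<close>

definition "act_left = tensor_pairing C H (H \<odot> H) H H \<mu> adj_left"
definition "act_right = tensor_pairing C H H H (H \<odot> H) \<mu> adj_right"

lemma act_simps [simp]: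
  "act_left \<in> Arr C" "Dom C act_left = H \<odot> (H \<odot> (H \<odot> (H \<odot> H)))" "Cod C act_left = H \<odot> H"
  "act_right \<in> Arr C" "Dom C act_right = H \<odot> (H \<odot> (H \<odot> (H \<odot> H)))" "Cod C act_right = H \<odot> H"
  by (simp_all add: act_left_def act_right_def)

lemma \<mu>3_hom: "\<mu>3 \<in> hom C ((H \<odot> (H \<odot> H)) \<odot> (H \<odot> (H \<odot> H))) (H \<odot> (H \<odot> H))"
  and act_left_hom: "act_left \<in> hom C ((H \<odot> (H \<odot> H)) \<odot> (H \<odot> H)) (H \<odot> H)"
  and act_right_hom: "act_right \<in> hom C ((H \<odot> H) \<odot> (H \<odot> (H \<odot> H))) (H \<odot> H)"
  by (simp_all add: hom_iff)

lemma act_left_assoc: "act_left \<cdot> (\<mu>3 \<otimes> \<one> (H \<odot> H)) = act_left \<cdot> (\<one> (H \<odot> (H \<odot> H)) \<otimes> act_left)"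
  unfolding act_left_def \<mu>3_def
  by (rule tensor_pairing_assoc[OF H_hom(2) \<mu>2_hom H_hom(2) adj_left_hom H_hom(2) adj_left_hom H_hom(2) adj_left_hom])
    (simp_all add: mult_assoc adj_left_assoc)

lemma act_right_assoc: "act_right \<cdot> (act_right \<otimes> \<one> (H \<odot> (H \<odot> H))) = act_right \<cdot> (\<one> (H \<odot> H) \<otimes> \<mu>3)"
  unfolding act_right_def \<mu>3_def
  by (rule tensor_pairing_assoc[OF H_hom(2) adj_right_hom H_hom(2) \<mu>2_hom H_hom(2) adj_right_hom H_hom(2) adj_right_hom])
    (simp_all add: mult_assoc adj_right_assoc)

lemma act_left_conv_assoc:
  "\<lbrakk>x \<in> Arr C; Cod C x = H \<odot> (H \<odot> H); y \<in> Arr C; Cod C y = H \<odot> (H \<odot> H); z \<in> Arr C; Cod C z = H \<odot> H\<rbrakk>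
    \<Longrightarrow> conv C act_left (x \<star>\<^sub>3 y) z = conv C act_left x (conv C act_left y z)"
  by (rule conv_assoc[OF act_left_assoc \<mu>3_hom act_left_hom act_left_hom act_left_hom]) simp_all

lemma act_right_conv_assoc:
  "\<lbrakk>x \<in> Arr C; Cod C x = H \<odot> (H \<odot> H); y \<in> Arr C; Cod C y = H \<odot> (H \<odot> H); z \<in> Arr C; Cod C z = H \<odot> H\<rbrakk>
    \<Longrightarrow> conv C act_right z (x \<star>\<^sub>3 y) = conv C act_right (conv C act_right z x) y"
  by (rule conv_assoc[OF act_right_assoc act_right_hom \<mu>3_hom act_right_hom act_right_hom, symmetric]) simp_all

lemmas act_left_tensor = tensor_pairing_tensor_unit[OF H_hom(2) adj_left_hom, folded act_left_def]
lemmas act_right_tensor = tensor_pairing_tensor_unit[OF H_hom(2) adj_right_hom, folded act_right_def]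

text \<open>For \<open>k = \<eta>\<close> the left action on the unit applies \<open>b \<otimes> c \<mapsto> b S(c)\<close> to the last two factors; for \<open>k = u'\<close> it
applies the same expression with \<open>SJ\<close>, except for a missing factor \<open>u\<close> on the right.\<close>

lemma act_left_conv_const:
  assumes [simp]: "x \<in> Arr C" "Cod C x = H \<odot> (H \<odot> H)" "k \<in> Arr C" "Dom C k = \<bbbK>" "Cod C k = H"
  shows "conv C act_left x (\<eta> \<otimes> k) = (\<one> H \<otimes> (\<one> H \<star>\<^sub>1 (k \<star>\<^sub>1 S))) \<cdot> x"
proof -
  have "conv C act_left (\<one> H \<otimes> \<one> (H \<odot> H)) (\<eta> \<otimes> k) = \<one> H \<otimes> (\<one> H \<star>\<^sub>1 (k \<star>\<^sub>1 S))"
    by (subst act_left_tensor) (simp_all add: adj_left_conv_id)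
  then show ?thesis
    using conv_cmp_left[of act_left "\<one> H \<otimes> \<one> (H \<odot> H)" "\<eta> \<otimes> k" x] by (simp add: tensor_ident)
qed

lemma act_right_conv_const:
  assumes [simp]: "x \<in> Arr C" "Cod C x = H \<odot> (H \<odot> H)" "k \<in> Arr C" "Dom C k = \<bbbK>" "Cod C k = H"
  shows "conv C act_right (\<eta> \<otimes> k) x = (\<one> H \<otimes> ((S \<star>\<^sub>1 k) \<star>\<^sub>1 \<one> H)) \<cdot> x"
proof -
  have "conv C act_right (\<eta> \<otimes> k) (\<one> H \<otimes> \<one> (H \<odot> H)) = \<one> H \<otimes> ((S \<star>\<^sub>1 k) \<star>\<^sub>1 \<one> H)"
    by (subst act_right_tensor) (simp_all add: adj_right_conv_id)
  then show ?thesis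
    using conv_cmp_right[of act_right "\<eta> \<otimes> k" "\<one> H \<otimes> \<one> (H \<odot> H)" x] by (simp add: tensor_ident)
qed

lemma mult_S_right_conv: "\<one> H \<star>\<^sub>1 S = mult_S_right" and mult_S_left_conv: "S \<star>\<^sub>1 \<one> H = mult_S_left"
  by (simp_all add: mult_S_right_def mult_S_left_def conv_def)

text \<open>In the left action the first factor only multiplies, so the \<open>h\<close> in \<open>h \<otimes> 1\<close> can be split off. This
allows a factor to act when \<open>h \<otimes> 1\<close> has already been produced by an antipode equation.\<close>

lemma act_left_conv_mult:
  assumes [simp]: "x \<in> Arr C" "Cod C x = H \<odot> (H \<odot> H)"
  shows "conv C act_left x (\<one> H \<otimes> \<eta>) = ((\<one> H \<otimes> mult_S_right) \<cdot> x) \<star>\<^sub>2 (\<one> H \<otimes> \<eta>)"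
proof -
  have "conv C act_left (\<one> H \<otimes> \<one> (H \<odot> H)) (\<one> H \<otimes> \<eta>)
      = ((\<one> H \<star>\<^sub>1 \<one> H) \<otimes> mult_S_right) \<cdot> (\<one> H \<otimes> \<sigma> (H \<odot> H) H \<otimes> \<one> \<bbbK>)"
    unfolding act_left_def
    by (subst tensor_pairing_tensor[OF H_hom(2) adj_left_hom ident_closed ident_closed ident_closed H_hom(1)])
      (simp_all add: adj_left_conv_unit)
  also have "\<dots> = (\<one> H \<otimes> mult_S_right) \<star>\<^sub>2 (\<one> H \<otimes> \<eta>)"
    unfolding \<mu>2_def
    by (subst tensor_pairing_tensor[OF H_hom(2) H_hom(2) ident_closed _ ident_closed H_hom(1), where g = mult_S_right and Y = "H \<odot> H"])
      (simp_all add: hom_iff)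
  finally have "conv C act_left (\<one> H \<otimes> \<one> (H \<odot> H)) (\<one> H \<otimes> \<eta>) = (\<one> H \<otimes> mult_S_right) \<star>\<^sub>2 (\<one> H \<otimes> \<eta>)" .
  then show ?thesis
    using conv_cmp_left[of act_left "\<one> H \<otimes> \<one> (H \<odot> H)" "\<one> H \<otimes> \<eta>" x]
      conv_cmp_left[of \<mu>2 "\<one> H \<otimes> mult_S_right" "\<one> H \<otimes> \<eta>" x] by (simp add: tensor_ident)
qed

lemma act_right_conv_mult:
  assumes [simp]: "x \<in> Arr C" "Cod C x = H \<odot> (H \<odot> H)"
  shows "conv C act_right (\<one> H \<otimes> \<eta>) x = (\<one> H \<otimes> \<eta>) \<star>\<^sub>2 ((\<one> H \<otimes> mult_S_left) \<cdot> x)"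
proof -
  have "conv C act_right (\<one> H \<otimes> \<eta>) (\<one> H \<otimes> \<one> (H \<odot> H)) = (\<one> H \<star>\<^sub>1 \<one> H) \<otimes> mult_S_left"
    by (subst act_right_tensor) (simp_all add: adj_right_conv_unit)
  also have "\<dots> = (\<one> H \<otimes> \<eta>) \<star>\<^sub>2 (\<one> H \<otimes> mult_S_left)"
    by (subst conv2_tensor) simp_all
  finally show ?thesis
    using conv_cmp_right[of act_right "\<one> H \<otimes> \<eta>" "\<one> H \<otimes> \<one> (H \<odot> H)" x]
      conv_cmp_right[of \<mu>2 "\<one> H \<otimes> \<eta>" "\<one> H \<otimes> mult_S_left" x] by (simp add: tensor_ident)
qed

lemma conv2_const:
  assumes [simp]: "x \<in> Arr C" "Cod C x = H \<odot> Dom C f" "f \<in> Arr C" "Cod C f = H"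
    "k \<in> Arr C" "Dom C k = \<bbbK>" "Cod C k = H"
  shows "((\<one> H \<otimes> f) \<cdot> x) \<star>\<^sub>2 (\<eta> \<otimes> k) = (\<one> H \<otimes> (f \<star>\<^sub>1 k)) \<cdot> x"
    and "(\<eta> \<otimes> k) \<star>\<^sub>2 ((\<one> H \<otimes> f) \<cdot> x) = (\<one> H \<otimes> (k \<star>\<^sub>1 f)) \<cdot> x"
proof -
  have "(\<one> H \<otimes> f) \<star>\<^sub>2 (\<eta> \<otimes> k) = \<one> H \<otimes> (f \<star>\<^sub>1 k)" "(\<eta> \<otimes> k) \<star>\<^sub>2 (\<one> H \<otimes> f) = \<one> H \<otimes> (k \<star>\<^sub>1 f)"
    by (subst conv2_tensor; simp)+
  then show "((\<one> H \<otimes> f) \<cdot> x) \<star>\<^sub>2 (\<eta> \<otimes> k) = (\<one> H \<otimes> (f \<star>\<^sub>1 k)) \<cdot> x"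
    "(\<eta> \<otimes> k) \<star>\<^sub>2 ((\<one> H \<otimes> f) \<cdot> x) = (\<one> H \<otimes> (k \<star>\<^sub>1 f)) \<cdot> x"
    by (simp_all add: conv_cmp_left conv_cmp_right)
qed

end

section \<open>Twisting\<close>

locale twisted_coquasigroup = hopf_coquasigroup C H \<eta> \<mu> \<epsilon> \<delta> S
  for C :: "('o, 'a, 'm) sm_struct_scheme" (structure) and H \<eta> \<mu> \<epsilon> \<delta> S +
  fixes J Q :: 'a
  assumes J_hom: "J \<in> hom C \<bbbK> (H \<odot> H)" and Q_hom: "Q \<in> hom C \<bbbK> (H \<odot> H)"
    and JQ: "J \<star>\<^sub>2 Q = \<eta> \<otimes> \<eta>" and QJ: "Q \<star>\<^sub>2 J = \<eta> \<otimes> \<eta>"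
    and twist: "((\<delta> \<otimes> \<one> H) \<cdot> J) \<star>\<^sub>3 (J \<otimes> \<eta>) = ((\<one> H \<otimes> \<delta>) \<cdot> J) \<star>\<^sub>3 (\<eta> \<otimes> J)"
    and conormal: "(\<epsilon> \<otimes> \<one> H) \<cdot> J = \<eta>" "(\<one> H \<otimes> \<epsilon>) \<cdot> J = \<eta>"
begin

lemmas JQ_simps [simp] = J_hom[THEN hom_Arr] J_hom[THEN hom_Dom] J_hom[THEN hom_Cod]
  Q_hom[THEN hom_Arr] Q_hom[THEN hom_Dom] Q_hom[THEN hom_Cod]

lemma tensor_unit_comult: "(\<delta> \<otimes> \<one> H) \<cdot> (\<eta> \<otimes> \<eta>) = \<eta> \<otimes> (\<eta> \<otimes> \<eta>)" "(\<one> H \<otimes> \<delta>) \<cdot> (\<eta> \<otimes> \<eta>) = \<eta> \<otimes> (\<eta> \<otimes> \<eta>)"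
  by (simp_all add: interchange_Arr tensor_arr_assoc)

lemma whiskered_inverses:
  shows "((\<delta> \<otimes> \<one> H) \<cdot> J) \<star>\<^sub>3 ((\<delta> \<otimes> \<one> H) \<cdot> Q) = \<eta> \<otimes> (\<eta> \<otimes> \<eta>)"
    and "((\<one> H \<otimes> \<delta>) \<cdot> Q) \<star>\<^sub>3 ((\<one> H \<otimes> \<delta>) \<cdot> J) = \<eta> \<otimes> (\<eta> \<otimes> \<eta>)"
    and "(J \<otimes> \<eta>) \<star>\<^sub>3 (Q \<otimes> \<eta>) = \<eta> \<otimes> (\<eta> \<otimes> \<eta>)"
    and "(\<eta> \<otimes> Q) \<star>\<^sub>3 (\<eta> \<otimes> J) = \<eta> \<otimes> (\<eta> \<otimes> \<eta>)"
proof -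
  show "((\<delta> \<otimes> \<one> H) \<cdot> J) \<star>\<^sub>3 ((\<delta> \<otimes> \<one> H) \<cdot> Q) = \<eta> \<otimes> (\<eta> \<otimes> \<eta>)"
    "((\<one> H \<otimes> \<delta>) \<cdot> Q) \<star>\<^sub>3 ((\<one> H \<otimes> \<delta>) \<cdot> J) = \<eta> \<otimes> (\<eta> \<otimes> \<eta>)"
    by (simp_all add: tensor_unit_comult JQ QJ flip: comult_conv)
  show "(J \<otimes> \<eta>) \<star>\<^sub>3 (Q \<otimes> \<eta>) = \<eta> \<otimes> (\<eta> \<otimes> \<eta>)"
    by (subst conv3_tensor') (simp_all add: JQ tensor_arr_assoc)
  show "(\<eta> \<otimes> Q) \<star>\<^sub>3 (\<eta> \<otimes> J) = \<eta> \<otimes> (\<eta> \<otimes> \<eta>)"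
    by (subst conv3_tensor) (simp_all add: QJ)
qed

lemma cancel_left_inverse:
  assumes "x \<in> Arr C" "Cod C x = H \<odot> (H \<odot> H)" "y \<in> Arr C" "Cod C y = H \<odot> (H \<odot> H)" "z \<in> Arr C" "Cod C z = H \<odot> (H \<odot> H)"
    and "x \<star>\<^sub>3 y = \<eta> \<otimes> (\<eta> \<otimes> \<eta>)"
  shows "x \<star>\<^sub>3 (y \<star>\<^sub>3 z) = z"
  using assms monoid_conv_assoc[OF monoid3, of x y z] by simp

text \<open>The twist equation \<open>(\<delta> \<otimes> H)(J) (J \<otimes> 1) = (H \<otimes> \<delta>)(J) (1 \<otimes> J)\<close>, multiplied by \<open>(H \<otimes> \<delta>)(Q)\<close> on the left
and by \<open>Q \<otimes> 1\<close> on the right.\<close>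

lemma mixed_twist:
  "((\<one> H \<otimes> \<delta>) \<cdot> Q) \<star>\<^sub>3 ((\<delta> \<otimes> \<one> H) \<cdot> J) = (\<eta> \<otimes> J) \<star>\<^sub>3 (Q \<otimes> \<eta>)"
proof -
  have "(\<delta> \<otimes> \<one> H) \<cdot> J = ((\<delta> \<otimes> \<one> H) \<cdot> J) \<star>\<^sub>3 ((J \<otimes> \<eta>) \<star>\<^sub>3 (Q \<otimes> \<eta>))"
    by (simp add: whiskered_inverses)
  also have "\<dots> = ((\<one> H \<otimes> \<delta>) \<cdot> J) \<star>\<^sub>3 ((\<eta> \<otimes> J) \<star>\<^sub>3 (Q \<otimes> \<eta>))"
    by (simp add: twist flip: conv_assocs)
  finally show ?thesis
    by (simp add: cancel_left_inverse whiskered_inverses)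
qed

text \<open>Inverting the twist equation. Read in the mirror category it says that \<open>Q\<close> is a twist.\<close>

lemma inverse_twist:
  "(Q \<otimes> \<eta>) \<star>\<^sub>3 ((\<delta> \<otimes> \<one> H) \<cdot> Q) = (\<eta> \<otimes> Q) \<star>\<^sub>3 ((\<one> H \<otimes> \<delta>) \<cdot> Q)"
proof -
  have "Q \<otimes> \<eta> = (\<eta> \<otimes> Q) \<star>\<^sub>3 ((\<eta> \<otimes> J) \<star>\<^sub>3 (Q \<otimes> \<eta>))"
    by (simp add: cancel_left_inverse whiskered_inverses)
  then have "(Q \<otimes> \<eta>) \<star>\<^sub>3 ((\<delta> \<otimes> \<one> H) \<cdot> Q)
     = (\<eta> \<otimes> Q) \<star>\<^sub>3 (((\<one> H \<otimes> \<delta>) \<cdot> Q) \<star>\<^sub>3 ((\<delta> \<otimes> \<one> H) \<cdot> J)) \<star>\<^sub>3 ((\<delta> \<otimes> \<one> H) \<cdot> Q)"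
    by (simp add: mixed_twist)
  then show ?thesis by (simp add: conv_assocs whiskered_inverses)
qed

definition "u = mult_S_left \<cdot> J"
definition "u' = mult_S_right \<cdot> Q"

lemma u_simps [simp]: "u \<in> Arr C" "Dom C u = \<bbbK>" "Cod C u = H" "u' \<in> Arr C" "Dom C u' = \<bbbK>" "Cod C u' = H"
  by (simp_all add: u_def u'_def)

lemma conormal_inverse: "(\<epsilon> \<otimes> \<one> H) \<cdot> Q = \<eta>" "(\<one> H \<otimes> \<epsilon>) \<cdot> Q = \<eta>"
proof -
  have "(\<epsilon> \<otimes> \<one> H) \<cdot> (\<eta> \<otimes> \<eta>) = \<eta>" "(\<one> H \<otimes> \<epsilon>) \<cdot> (\<eta> \<otimes> \<eta>) = \<eta>"
    by (simp_all add: interchange_Arr)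
  then have "((\<epsilon> \<otimes> \<one> H) \<cdot> J) \<star>\<^sub>1 ((\<epsilon> \<otimes> \<one> H) \<cdot> Q) = \<eta>"
    "((\<one> H \<otimes> \<epsilon>) \<cdot> J) \<star>\<^sub>1 ((\<one> H \<otimes> \<epsilon>) \<cdot> Q) = \<eta>"
    by (simp_all add: JQ flip: comult_conv)
  then show "(\<epsilon> \<otimes> \<one> H) \<cdot> Q = \<eta>" "(\<one> H \<otimes> \<epsilon>) \<cdot> Q = \<eta>" by (simp_all add: conormal)
qed

lemma mult_S_right_unit: "mult_S_right \<cdot> (\<eta> \<otimes> \<eta>) = \<eta>" and mult_S_left_unit: "mult_S_left \<cdot> (\<eta> \<otimes> \<eta>) = \<eta>"
  using mult_S_right_comult mult_S_left_comult cmp_assoc_Arr[of \<eta> \<delta> mult_S_right] cmp_assoc_Arr[of \<eta> \<delta> mult_S_left]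
  by (simp_all add: cmp_assoc_Arr)

text \<open>\<open>u'\<close> is the result of \<open>Q\<close> acting on the unit, so \<open>J\<close> acting on \<open>u'\<close> is \<open>J Q = 1\<close> acting on the unit.\<close>

lemma adj_left_J_u': "conv C adj_left J u' = \<eta>"
  using adj_left_conv_assoc[of J Q \<eta>] by (simp add: adj_left_conv_unit JQ mult_S_right_unit u'_def)

lemma adj_right_u_Q: "conv C adj_right u Q = \<eta>"
  using adj_right_conv_assoc[of J Q \<eta>] by (simp add: adj_right_conv_unit JQ mult_S_left_unit u_def)

text \<open>For \<open>y = J\<close> this is \<open>J1 \<otimes> J21 S(J22) = J1 \<otimes> \<epsilon>(J2) 1 = 1 \<otimes> 1\<close>, and likewise for \<open>S(J21) J22\<close> and for \<open>Q\<close>.\<close>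

lemma whisker_comult:
  assumes [simp]: "T \<in> Arr C" "Dom C T = H \<odot> H" "Cod C T = H" "y \<in> Arr C" "Cod C y = H \<odot> H"
    and T: "T \<cdot> \<delta> = \<eta> \<cdot> \<epsilon>" and y: "(\<one> H \<otimes> \<epsilon>) \<cdot> y = \<eta>"
  shows "(\<one> H \<otimes> T) \<cdot> (\<one> H \<otimes> \<delta>) \<cdot> y = \<eta> \<otimes> \<eta>"
proof -
  have "Dom C y = \<bbbK>" using arg_cong[OF y, of "Dom C"] by simp
  have *: "(\<one> H \<otimes> T) \<cdot> (\<one> H \<otimes> \<delta>) = (\<one> H \<otimes> \<eta>) \<cdot> (\<one> H \<otimes> \<epsilon>)"
    by (simp add: T interchange_Arr)
  have "(\<one> H \<otimes> T) \<cdot> (\<one> H \<otimes> \<delta>) \<cdot> y = (\<one> H \<otimes> \<eta>) \<cdot> \<eta>"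
    by (simp add: cmp_reassoc[OF *] cmp_assoc_Arr y)
  also have "\<dots> = \<eta> \<otimes> \<eta>"
    using interchange_Arr[of \<eta> "\<one> H" "\<one> \<bbbK>" \<eta>] by simp
  finally show ?thesis .
qed

text \<open>Apply \<open>a \<otimes> b \<otimes> c \<mapsto> a S(b) c\<close> to \<open>mixed_twist\<close>. On the right this gives \<open>Q1 S(J1 Q2) J2 = Q1 S(Q2) S(J1) J2\<close>,
which is \<open>u' u\<close>. On the left it gives \<open>Q1 J11 S(J12) S(Q21) Q22 J2\<close>, which collapses to 1 by conormality.
To avoid permuting factors by hand, \<open>b \<otimes> c \<mapsto> S(b) c\<close> is taken first, as the right action on \<open>1 \<otimes> 1\<close>.\<close>

lemma u'_u: "u' \<star>\<^sub>1 u = \<eta>"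
proof -
  have "conv C act_right (\<eta> \<otimes> \<eta>) (((\<one> H \<otimes> \<delta>) \<cdot> Q) \<star>\<^sub>3 ((\<delta> \<otimes> \<one> H) \<cdot> J)) = (\<one> H \<otimes> mult_S_left) \<cdot> (\<delta> \<otimes> \<one> H) \<cdot> J"
    by (simp add: act_right_conv_assoc act_right_conv_const mult_S_left_conv whisker_comult mult_S_left_comult conormal_inverse)
  moreover have "conv C act_right (\<eta> \<otimes> \<eta>) ((\<eta> \<otimes> J) \<star>\<^sub>3 (Q \<otimes> \<eta>)) = (\<one> H \<otimes> ((S \<star>\<^sub>1 u) \<star>\<^sub>1 \<one> H)) \<cdot> (Q \<otimes> \<eta>)"
  proof -
    have "conv C act_right (\<eta> \<otimes> \<eta>) (\<eta> \<otimes> J) = \<eta> \<otimes> u"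
      by (subst act_right_tensor) (simp_all add: adj_right_conv_unit u_def)
    then show ?thesis by (simp add: act_right_conv_assoc act_right_conv_const)
  qed
  ultimately have "(\<one> H \<otimes> mult_S_left) \<cdot> (\<delta> \<otimes> \<one> H) \<cdot> J = (\<one> H \<otimes> ((S \<star>\<^sub>1 u) \<star>\<^sub>1 \<one> H)) \<cdot> (Q \<otimes> \<eta>)"
    by (simp add: mixed_twist)
  then have "\<mu> \<cdot> (\<one> H \<otimes> mult_S_left) \<cdot> (\<delta> \<otimes> \<one> H) \<cdot> J = (\<mu> \<cdot> (\<one> H \<otimes> ((S \<star>\<^sub>1 u) \<star>\<^sub>1 \<one> H))) \<cdot> (Q \<otimes> \<eta>)"
    by (simp add: cmp_assoc_Arr)
  also have "\<mu> \<cdot> (\<one> H \<otimes> ((S \<star>\<^sub>1 u) \<star>\<^sub>1 \<one> H)) = (\<one> H \<star>\<^sub>1 S) \<star>\<^sub>1 (u \<star>\<^sub>1 \<one> H)"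
    by (simp add: conv_assocs) (simp add: conv_def[of C \<mu> "\<one> H"])
  also have "((\<one> H \<star>\<^sub>1 S) \<star>\<^sub>1 (u \<star>\<^sub>1 \<one> H)) \<cdot> (Q \<otimes> \<eta>) = u' \<star>\<^sub>1 ((u \<star>\<^sub>1 \<one> H) \<cdot> \<eta>)"
    by (simp add: mult_S_right_conv u'_def conv_cmp)
  also have "(u \<star>\<^sub>1 \<one> H) \<cdot> \<eta> = u"
    using conv_cmp_right[of \<mu> u "\<one> H" \<eta>] by simp
  also have "\<mu> \<cdot> (\<one> H \<otimes> mult_S_left) \<cdot> (\<delta> \<otimes> \<one> H) \<cdot> J = \<eta>"
  proof -
    have "\<mu> \<cdot> (\<one> H \<otimes> mult_S_left) = \<one> H \<star>\<^sub>1 (S \<star>\<^sub>1 \<one> H)"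
      by (simp add: conv_def[of C \<mu> "\<one> H"] mult_S_left_conv)
    also have "\<dots> = mult_S_right \<star>\<^sub>1 \<one> H"
      by (simp add: mult_S_right_conv flip: conv_assocs)
    finally have "(\<mu> \<cdot> (\<one> H \<otimes> mult_S_left)) \<cdot> (\<delta> \<otimes> \<one> H) \<cdot> J = (mult_S_right \<cdot> \<delta>) \<star>\<^sub>1 \<one> H \<cdot> J"
      by (simp add: conv_cmp_left cmp_assoc_Arr)
    also have "\<dots> = \<eta>"
      by (simp add: mult_S_right_comult conv_cmp_left cmp_assoc_Arr conormal)
    finally show ?thesis by (simp add: cmp_assoc_Arr)
  qed
  finally show ?thesis by simp
qed

text \<open>The coproduct and, as will turn out, the antipode of the twist deformation \<open>H_J\<close>.\<close>

definition "\<delta>J = (Q \<star>\<^sub>2 \<delta>) \<star>\<^sub>2 J"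
definition "SJ = u' \<star>\<^sub>1 (S \<star>\<^sub>1 u)"

lemma \<delta>J_simps [simp]: "\<delta>J \<in> Arr C" "Dom C \<delta>J = H" "Cod C \<delta>J = H \<odot> H"
  "SJ \<in> Arr C" "Dom C SJ = H" "Cod C SJ = H"
  by (simp_all add: \<delta>J_def SJ_def)

lemma conv_const_cmp:
  assumes "p \<in> Arr C" "a \<in> Arr C" "b \<in> Arr C" "Dom C a = \<bbbK>" "Dom C b = \<bbbK>" "f \<in> Arr C"
   "Dom C p = Cod C a \<odot> Cod C f" "Dom C p = Cod C p \<odot> Cod C b" "x \<in> Arr C" "Cod C x = Dom C f"
 shows "conv C p (conv C p a f) b \<cdot> x = conv C p (conv C p a (f \<cdot> x)) b"
  using assms by (simp add: conv_cmp_right conv_cmp_left)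

text \<open>\<open>\<delta> \<otimes> H\<close> is multiplicative, hence \<open>(\<delta>J \<otimes> H) \<delta>J(h)\<close> is
\<open>(Q \<otimes> 1) (\<delta> \<otimes> H)(Q) (\<delta> \<otimes> H)(\<delta>(h)) (\<delta> \<otimes> H)(J) (J \<otimes> 1)\<close>. Rewriting the outer factors by the twist equation
moves \<open>J\<close> and \<open>Q\<close> to the last two tensor factors, where the antipode acts.\<close>

lemma twisted_comult_iterated:
  "(\<delta>J \<otimes> \<one> H) \<cdot> \<delta>J = (\<eta> \<otimes> Q) \<star>\<^sub>3 (((\<one> H \<otimes> \<delta>) \<cdot> Q) \<star>\<^sub>3 (((\<delta> \<otimes> \<one> H) \<cdot> \<delta>) \<star>\<^sub>3
      (((\<one> H \<otimes> \<delta>) \<cdot> J) \<star>\<^sub>3 (\<eta> \<otimes> J))))"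
proof -
  have "\<delta>J \<otimes> \<one> H = ((Q \<otimes> \<eta>) \<star>\<^sub>3 (\<delta> \<otimes> \<one> H)) \<star>\<^sub>3 (J \<otimes> \<eta>)"
  proof -
    have "(Q \<otimes> \<eta>) \<star>\<^sub>3 (\<delta> \<otimes> \<one> H) = (Q \<star>\<^sub>2 \<delta>) \<otimes> \<one> H"
      by (subst conv3_tensor') simp_all
    moreover have "((Q \<star>\<^sub>2 \<delta>) \<otimes> \<one> H) \<star>\<^sub>3 (J \<otimes> \<eta>) = \<delta>J \<otimes> \<one> H"
      by (subst conv3_tensor') (simp_all add: \<delta>J_def)
    ultimately show ?thesis by simp
  qed
  then have "(\<delta>J \<otimes> \<one> H) \<cdot> \<delta>J = ((Q \<otimes> \<eta>) \<star>\<^sub>3 ((\<delta> \<otimes> \<one> H) \<cdot> \<delta>J)) \<star>\<^sub>3 (J \<otimes> \<eta>)"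
    by (simp add: conv_const_cmp)
  also have "\<dots> = ((Q \<otimes> \<eta>) \<star>\<^sub>3 ((\<delta> \<otimes> \<one> H) \<cdot> Q)) \<star>\<^sub>3 (((\<delta> \<otimes> \<one> H) \<cdot> \<delta>) \<star>\<^sub>3
      (((\<delta> \<otimes> \<one> H) \<cdot> J) \<star>\<^sub>3 (J \<otimes> \<eta>)))"
    by (simp add: \<delta>J_def comult_conv conv_assocs)
  also have "\<dots> = ((\<eta> \<otimes> Q) \<star>\<^sub>3 ((\<one> H \<otimes> \<delta>) \<cdot> Q)) \<star>\<^sub>3 (((\<delta> \<otimes> \<one> H) \<cdot> \<delta>) \<star>\<^sub>3
      (((\<one> H \<otimes> \<delta>) \<cdot> J) \<star>\<^sub>3 (\<eta> \<otimes> J)))"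
    by (simp only: inverse_twist twist)
  finally show ?thesis by (simp add: conv_assocs)
qed

text \<open>The factors of the iterated coproduct act on \<open>1 \<otimes> u'\<close> from the innermost one outwards; the values
are in turn \<open>1 \<otimes> 1\<close>, \<open>1 \<otimes> 1\<close>, \<open>h \<otimes> 1\<close>, \<open>h \<otimes> 1\<close> and \<open>h \<otimes> u'\<close>.\<close>

lemma twisted_antipode_right:
  "(\<one> H \<otimes> \<mu>) \<cdot> (\<delta>J \<otimes> SJ) \<cdot> \<delta>J = \<one> H \<otimes> \<eta>"
proof -
  let ?X = "(\<delta>J \<otimes> \<one> H) \<cdot> \<delta>J"
  have a: "conv C act_left (\<eta> \<otimes> J) (\<eta> \<otimes> u') = \<eta> \<otimes> \<eta>"
    by (subst act_left_tensor) (simp_all add: adj_left_J_u')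
  have b: "conv C act_left (\<eta> \<otimes> Q) (\<one> H \<otimes> \<eta>) = \<one> H \<otimes> u'"
    by (subst act_left_tensor) (simp_all add: adj_left_conv_unit u'_def)
  have c: "conv C act_left ?X (\<eta> \<otimes> u') = \<one> H \<otimes> u'"
    unfolding twisted_comult_iterated
    by (simp add: act_left_conv_assoc a act_left_conv_const[of _ \<eta>] mult_S_right_conv whisker_comult
        mult_S_right_comult conormal conormal_inverse antipode_mult_S_right act_left_conv_mult[of "(\<one> H \<otimes> \<delta>) \<cdot> Q"] b)
  have "(\<one> H \<otimes> u') \<star>\<^sub>2 (\<eta> \<otimes> u) = (\<one> H \<otimes> (\<one> H \<star>\<^sub>1 SJ)) \<cdot> ?X"
    unfolding c[symmetric] by (simp add: act_left_conv_const conv2_const SJ_def conv_assocs)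
  moreover have "(\<one> H \<otimes> u') \<star>\<^sub>2 (\<eta> \<otimes> u) = \<one> H \<otimes> \<eta>"
    by (subst conv2_tensor) (simp_all add: u'_u)
  ultimately show ?thesis
    using whiskered_mult(1)[of \<delta>J SJ] by (simp flip: cmp_assoc_Arr)
qed

text \<open>Here the factors act from the right on \<open>1 \<otimes> u\<close>, beginning with \<open>1 \<otimes> Q\<close>; the values are in turn
\<open>1 \<otimes> 1\<close>, \<open>1 \<otimes> 1\<close>, \<open>h \<otimes> 1\<close>, \<open>h \<otimes> 1\<close> and \<open>h \<otimes> u\<close>.\<close>

lemma twisted_antipode_left:
  "(\<one> H \<otimes> \<mu>) \<cdot> (((\<one> H \<otimes> SJ) \<cdot> \<delta>J) \<otimes> \<one> H) \<cdot> \<delta>J = \<one> H \<otimes> \<eta>"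
proof -
  let ?X = "(\<delta>J \<otimes> \<one> H) \<cdot> \<delta>J"
  have a: "conv C act_right (\<eta> \<otimes> u) (\<eta> \<otimes> Q) = \<eta> \<otimes> \<eta>"
    by (subst act_right_tensor) (simp_all add: adj_right_u_Q)
  have b: "conv C act_right (\<one> H \<otimes> \<eta>) (\<eta> \<otimes> J) = \<one> H \<otimes> u"
    by (subst act_right_tensor) (simp_all add: adj_right_conv_unit u_def)
  have c: "conv C act_right (\<eta> \<otimes> u) ?X = \<one> H \<otimes> u"
    unfolding twisted_comult_iterated
    by (simp add: act_right_conv_assoc a act_right_conv_const[of _ \<eta>] mult_S_left_conv whisker_comult
        mult_S_left_comult conormal conormal_inverse antipode_mult_S_left act_right_conv_mult[of "(\<one> H \<otimes> \<delta>) \<cdot> J"] b)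
  have "(\<eta> \<otimes> u') \<star>\<^sub>2 (\<one> H \<otimes> u) = (\<one> H \<otimes> (SJ \<star>\<^sub>1 \<one> H)) \<cdot> ?X"
    unfolding c[symmetric] by (simp add: act_right_conv_const conv2_const SJ_def conv_assocs)
  moreover have "(\<eta> \<otimes> u') \<star>\<^sub>2 (\<one> H \<otimes> u) = \<one> H \<otimes> \<eta>"
    by (subst conv2_tensor) (simp_all add: u'_u)
  ultimately show ?thesis
    using whiskered_mult(2)[of \<delta>J SJ] by (simp flip: cmp_assoc_Arr)
qed

text \<open>The mirror image multiplies in the opposite order, so \<open>Q\<close> takes over the role of \<open>J\<close>.\<close>

lemma mirror_twisted_coquasigroup: "twisted_coquasigroup (mirror C) H \<eta> \<mu> \<epsilon> \<delta> S Q J"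
  by (intro twisted_coquasigroup.intro mirror_hopf_coquasigroup twisted_coquasigroup_axioms.intro)
    (simp_all add: J_hom Q_hom JQ QJ mirror_\<mu>2 mirror_\<mu>3 inverse_twist conormal_inverse)

lemma mirror_\<delta>J: "twisted_coquasigroup.\<delta>J (mirror C) H \<mu> \<delta> Q J = \<delta>J"
  using twisted_coquasigroup.\<delta>J_def[OF mirror_twisted_coquasigroup]
  by (simp add: mirror_\<mu>2 \<delta>J_def conv_assocs)

lemma mirror_SJ: "twisted_coquasigroup.SJ (mirror C) H \<mu> S Q J = SJ"
  using twisted_coquasigroup.SJ_def[OF mirror_twisted_coquasigroup]
    twisted_coquasigroup.u_def[OF mirror_twisted_coquasigroup]
    twisted_coquasigroup.u'_def[OF mirror_twisted_coquasigroup]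
  by (simp add: mirror_mult_S_left mirror_mult_S_right SJ_def u_def u'_def conv_assocs)

text \<open>Two of the antipode equations are the previous lemmas, the other two are the same lemmas read in
the mirror category.\<close>

lemma twisted_antipode: "is_antipode C H \<eta> \<mu> \<delta>J SJ"
  using twisted_antipode_right twisted_antipode_left
    twisted_coquasigroup.twisted_antipode_right[OF mirror_twisted_coquasigroup]
    twisted_coquasigroup.twisted_antipode_left[OF mirror_twisted_coquasigroup]
  by (simp add: is_antipode_def mirror_\<delta>J mirror_SJ hom_iff)

lemma twisted_bimonoid: "is_noncoassociative_bimonoid C H \<eta> \<mu> \<epsilon> \<delta>J"
proof -
  have "\<delta>J \<cdot> \<eta> = \<eta> \<otimes> \<eta>"
    by (simp add: \<delta>J_def conv_const_cmp QJ)
  moreover have "(\<epsilon> \<otimes> \<one> H) \<cdot> \<delta>J = \<one> H" "(\<one> H \<otimes> \<epsilon>) \<cdot> \<delta>J = \<one> H"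
    by (simp_all add: \<delta>J_def comult_conv conormal conormal_inverse)
  moreover have "\<delta>J \<cdot> \<mu> = \<mu>2 \<cdot> (\<delta>J \<otimes> \<delta>J)"
  proof -
    have "\<delta>J \<cdot> \<mu> = (Q \<star>\<^sub>2 (\<delta> \<star>\<^sub>2 \<delta>)) \<star>\<^sub>2 J"
      by (simp add: \<delta>J_def conv_const_cmp comult_mult) (simp add: conv_def)
    \<comment> \<open>insert \<open>J Q = 1\<close> between the two coproducts\<close>
    also have "\<dots> = (Q \<star>\<^sub>2 (\<delta> \<star>\<^sub>2 ((J \<star>\<^sub>2 Q) \<star>\<^sub>2 \<delta>))) \<star>\<^sub>2 J"
      by (simp add: JQ)
    also have "\<dots> = \<delta>J \<star>\<^sub>2 \<delta>J"
      by (simp add: \<delta>J_def conv_assocs)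
    finally show ?thesis by (simp add: conv_def)
  qed
  ultimately show ?thesis
    using monoid1 by (simp add: is_noncoassociative_bimonoid_def is_counital_comagma_def hom_iff
        flip: \<mu>2_tensor_mult)
qed

end

lemma (in strict_symmetric_monoidal_category) conv_inverse_eq:
  assumes m: "is_monoid C A \<eta> \<mu>" and f: "f \<in> hom C \<bbbK> A" and g: "is_conv_inverse C A \<eta> \<mu> f g"
  shows "conv_inverse C A \<eta> \<mu> f = g"
  unfolding conv_inverse_def
proof (rule the_equality[of "is_conv_inverse C A \<eta> \<mu> f", OF g])
  fix h assume h: "is_conv_inverse C A \<eta> \<mu> f h"
  note [simp] = hom_Arr[OF f] hom_Cod[OF f]
  have [simp]: "g \<in> Arr C" "Cod C g = A" "h \<in> Arr C" "Cod C h = A"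
    using g h by (simp_all add: is_conv_inverse_def hom_iff)
  have "h = conv C \<mu> (conv C \<mu> g f) h"
    using g by (simp add: is_conv_inverse_def monoid_conv[OF m])
  also have "\<dots> = g"
    using h by (simp add: is_conv_inverse_def monoid_conv[OF m])
  finally show "h = g" .
qed

theorem corollary3p1p16:
  fixes C :: "('o, 'a, 'm) sm_struct_scheme"
    and H :: 'o and \<eta> \<mu> \<epsilon> \<delta> S J :: 'a
  assumes "strict_symmetric_monoidal_category C"
    and "is_hopf_coquasigroup C H \<eta> \<mu> \<epsilon> \<delta>"
    and "is_antipode C H \<eta> \<mu> \<delta> S"
    and "is_twist C H \<eta> \<mu> \<delta> J"
    and "is_conormal C H \<eta> \<epsilon> J"
  shows "is_hopf_coquasigroup C H \<eta> \<mu> \<epsilon> (twist_comult C H \<eta> \<mu> \<delta> J)"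
proof -
  interpret c: hopf_coquasigroup C H \<eta> \<mu> \<epsilon> \<delta> S
    using assms by (intro hopf_coquasigroup.intro hopf_coquasigroup_axioms.intro)
      (simp_all add: is_hopf_coquasigroup_def)
  have J: "J \<in> hom C (unit_obj C) (tensor_obj C H H)"
    using assms(4) by (simp add: is_twist_def Let_def)
  obtain Q where Q: "is_conv_inverse C (tensor_obj C H H) (tensor_arr C \<eta> \<eta>) c.\<mu>2 J Q"
    using assms(4) by (auto simp: is_twist_def Let_def c.\<mu>2_tensor_mult)
  have \<mu>3: "tensor_mult C (tensor_obj C H H) c.\<mu>2 H \<mu> = c.\<mu>3"
    by (simp add: c.\<mu>3_coherence tensor_mult_def tensor_pairing_def)
  interpret t: twisted_coquasigroup C H \<eta> \<mu> \<epsilon> \<delta> S J Q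
    using assms(4,5) Q J \<mu>3
    by unfold_locales (simp_all add: is_twist_def Let_def is_conormal_def is_conv_inverse_def
        flip: c.\<mu>2_tensor_mult)
  have "tensor_arr C c.\<mu>2 (ident C (tensor_obj C H H)) \<cdot>\<^bsub>C\<^esub> ((Q \<otimes>\<^bsub>C\<^esub> \<delta>) \<otimes>\<^bsub>C\<^esub> J) = (c.\<mu>2 \<cdot>\<^bsub>C\<^esub> (Q \<otimes>\<^bsub>C\<^esub> \<delta>)) \<otimes>\<^bsub>C\<^esub> J"
    by (simp add: c.interchange_Arr)
  then have "twist_comult C H \<eta> \<mu> \<delta> J = t.\<delta>J"
    using c.conv_inverse_eq[OF c.monoid2 J Q]
    by (simp add: twist_comult_def Let_def t.\<delta>J_def conv_def c.tensor_arr_assoc c.tensor_ident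
        flip: c.\<mu>2_tensor_mult)
  then show ?thesis
    using t.twisted_antipode t.twisted_bimonoid by (auto simp: is_hopf_coquasigroup_def)
qed

end
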